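(* Let $G$ be a connected semisimple complex algebraic group and let $V$ be a nontrivial irreducible finite dimensional $G$-module. Let $\mathbb{X}\subset\mathbb{P}=\mathbb{P}(V)$ be the unique closed $G$-orbit (the orbit of the highest weight line), with secant varieties $\sigma_r(\mathbb{X})$, $r\geq 1$. Let $J=\mathbb{C}[V]^G_{\geq 1}$, let $\mathbb{P}^{us}\subset\mathbb{P}$ be the zero locus of $J$, and let $\sqrt{I(J)}\subset\mathbb{C}[V]$ be the radical of the ideal of $\mathbb{C}[V]$ generated by $J$. (i) Suppose $\mathbb{C}[V]^G\neq\mathbb{C}$, let $d_1$ be the minimal positive degree of a generator of $\mathbb{C}[V]^G$, and let $r_{us}=\max\{r\in\mathbb{N}:\sigma_r(\mathbb{X})\subset\mathbb{P}^{us}\}$. Then $r_{us}<d_1$. (ii) If $\mathbb{P}^{us}\subset\sigma_r(\mathbb{X})\neq\mathbb{P}$ for some $r$, then $\sqrt{I(J)}_{r+1}$ contains the $(r-1)$-st prolongation of the degree $2$ component $I_2(\mathbb{X})$ of the ideal of $\mathbb{X}$, i.e. $$I_2(\mathbb{X})^{(r-1)}=(I_2(\mathbb{X})\otimes S^{r-1}V^* )\cap S^{r+1}V^*\subset\sqrt{I(J)}_{r+1}.$$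
   Context: $\mathbb{C}[V]^G$ is the graded ring of $G$-invariant polynomials on $V$, and $\mathbb{C}[V]^G_{\geq 1}$ is the ideal of invariants vanishing at $0$. $\mathbb{C}[V]^G$ admits a generator of degree $d>0$ if $\mathbb{C}[V]^G_d$ is not contained in the subring generated by the invariants of degree $<d$; when $\mathbb{C}[V]^G\neq\mathbb{C}$, the minimal such degree $d_1$ is the minimal positive degree of a nonzero homogeneous invariant. $\mathbb{P}^{us}$ is called the unstable locus (nullcone). The $r$-th secant variety is the Zariski closure $\sigma_r(\mathbb{X})=\overline{\bigcup_{x_1,\dots,x_r\in\mathbb{X}}\mathbb{P}\,\mathrm{Span}(x_1,\dots,x_r)}\subset\mathbb{P}$. $\mathbb{C}[V]$ is identified with the algebra of symmetric tensors $SV^*=\bigoplus_d S^dV^*$ inside the tensor algebra of $V^*$, so that $I_2(\mathbb{X})\subset S^2V^*$ and the intersection in (ii) takes place in $(V^* )^{\otimes(r+1)}$. A subscript $d$ on a homogeneous ideal denotes its degree $d$ component. *)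

theory Defs
  imports
    "HOL-Analysis.Analysis"
    "HOL-Library.Poly_Mapping"
    "HOL-Algebra.Solvable_Groups"
begin

section \<open>Polynomials\<close>

text \<open>Complex polynomials in finitely many variables indexed by \<^typ>\<open>'i\<close>, as finitely supported
  functions on exponent vectors. For the index type of \<^typ>\<open>complex^'m\<close> this is the coordinate
  ring of \<open>V = complex^'m\<close>, and for pairs of indices that of a space of square matrices.\<close>

type_synonym 'i cpoly = "('i \<Rightarrow>\<^sub>0 nat) \<Rightarrow>\<^sub>0 complex"

definition poly_eval :: "'i cpoly \<Rightarrow> ('i \<Rightarrow> complex) \<Rightarrow> complex" where
  "poly_eval p x = (\<Sum>m\<in>Poly_Mapping.keys p. Poly_Mapping.lookup p m *
     (\<Prod>i\<in>Poly_Mapping.keys m. x i ^ Poly_Mapping.lookup m i))"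

definition const_poly :: "complex \<Rightarrow> 'i cpoly" where
  "const_poly c = Poly_Mapping.single 0 c"

definition monomial_degree :: "('i \<Rightarrow>\<^sub>0 nat) \<Rightarrow> nat" where
  "monomial_degree m = (\<Sum>i\<in>Poly_Mapping.keys m. Poly_Mapping.lookup m i)"

definition homogeneous :: "nat \<Rightarrow> 'i cpoly set" where
  "homogeneous d = {p. \<forall>m\<in>Poly_Mapping.keys p. monomial_degree m = d}"

definition is_ideal :: "'a::comm_ring_1 set \<Rightarrow> bool" where
  "is_ideal I \<longleftrightarrow> 0 \<in> I \<and> (\<forall>a\<in>I. \<forall>b\<in>I. a + b \<in> I) \<and> (\<forall>a. \<forall>b\<in>I. a * b \<in> I)"

definition is_subring :: "'a::comm_ring_1 set \<Rightarrow> bool" where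
  "is_subring R \<longleftrightarrow> 1 \<in> R \<and> (\<forall>a\<in>R. \<forall>b\<in>R. a - b \<in> R) \<and> (\<forall>a\<in>R. \<forall>b\<in>R. a * b \<in> R)"

definition ideal_radical :: "'a::comm_ring_1 set \<Rightarrow> 'a set" where
  "ideal_radical I = {a. \<exists>k>0. a ^ k \<in> I}"


section \<open>Connected semisimple linear algebraic groups and their modules\<close>

definition GL :: "(complex^'n^'n) monoid" where
  "GL = \<lparr>carrier = {A. invertible A}, mult = (**), one = mat 1\<rparr>"

abbreviation mat_entries :: "complex^'n^'n \<Rightarrow> 'n \<times> 'n \<Rightarrow> complex" where
  "mat_entries A \<equiv> \<lambda>(i, j). A $ i $ j"

text \<open>The Zariski topology, given by its basis of principal open sets.\<close>

definition zariski_mat :: "(complex^'n^'n) topology" where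
  "zariski_mat = topology_generated_by (range (\<lambda>p. {A. poly_eval p (mat_entries A) \<noteq> 0}))"

definition linear_algebraic_group :: "(complex^'n^'n) set \<Rightarrow> bool" where
  "linear_algebraic_group G \<longleftrightarrow>
     subgroup G GL \<and> closedin (subtopology zariski_mat (carrier GL)) G"

text \<open>Semisimple: the radical (the largest closed connected solvable normal subgroup) is trivial.\<close>

definition connected_semisimple :: "(complex^'n^'n) set \<Rightarrow> bool" where
  "connected_semisimple G \<longleftrightarrow>
     linear_algebraic_group G \<and> connectedin zariski_mat G \<and>
     (\<forall>N. N \<lhd> GL\<lparr>carrier := G\<rparr> \<and> closedin (subtopology zariski_mat G) N \<and>
          connectedin zariski_mat N \<and> solvable (GL\<lparr>carrier := N\<rparr>) \<longrightarrow> N = {mat 1})"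

text \<open>The coordinate ring of \<^const>\<open>GL\<close> is generated by the matrix entries and the inverse of the
  determinant; regular functions on a closed subgroup are restrictions of elements of this ring.\<close>

definition regular_on :: "(complex^'n^'n) set \<Rightarrow> (complex^'n^'n \<Rightarrow> complex) \<Rightarrow> bool" where
  "regular_on G f \<longleftrightarrow> (\<exists>p k. \<forall>A\<in>G. f A = poly_eval p (mat_entries A) / det A ^ k)"

text \<open>A finite dimensional \<open>G\<close>-module structure on \<open>V = complex^'m\<close>: a homomorphism
  \<open>\<rho> : G \<rightarrow> GL(V)\<close> of algebraic groups. Only the values of \<open>\<rho>\<close> on \<open>G\<close> matter.\<close>

definition rational_module ::
  "(complex^'n^'n) set \<Rightarrow> (complex^'n^'n \<Rightarrow> complex^'m^'m) \<Rightarrow> bool" where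
  "rational_module G \<rho> \<longleftrightarrow>
     \<rho> \<in> hom (GL\<lparr>carrier := G\<rparr>) GL \<and> (\<forall>i j. regular_on G (\<lambda>g. \<rho> g $ i $ j))"

definition irreducible_module ::
  "(complex^'n^'n) set \<Rightarrow> (complex^'n^'n \<Rightarrow> complex^'m^'m) \<Rightarrow> bool" where
  "irreducible_module G \<rho> \<longleftrightarrow> rational_module G \<rho> \<and>
     (\<forall>W. vec.subspace W \<and> (\<forall>g\<in>G. \<forall>w\<in>W. \<rho> g *v w \<in> W) \<longrightarrow> W = {0} \<or> W = UNIV)"

definition nontrivial_module ::
  "(complex^'n^'n) set \<Rightarrow> (complex^'n^'n \<Rightarrow> complex^'m^'m) \<Rightarrow> bool" where
  "nontrivial_module G \<rho> \<longleftrightarrow> (\<exists>g\<in>G. \<exists>v. \<rho> g *v v \<noteq> v)"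


section \<open>Projective space\<close>

text \<open>Points of \<open>\<bbbP>(V)\<close> are lines through the origin of \<open>V\<close>, as sets of vectors;
  \<open>proj W\<close> is the set of lines contained in the linear subspace \<open>W\<close>.\<close>

definition proj :: "(complex^'m) set \<Rightarrow> (complex^'m) set set" where
  "proj W = {vec.span {v} | v. v \<in> W \<and> v \<noteq> 0}"

definition zariski_proj :: "(complex^'m) set topology" where
  "zariski_proj = topology_generated_by
     {{l \<in> proj UNIV. \<forall>v\<in>l - {0}. poly_eval p (($) v) \<noteq> 0} | p. \<exists>d. p \<in> homogeneous d}"

definition zero_locus :: "'m cpoly set \<Rightarrow> (complex^'m) set set" where
  "zero_locus S = {l \<in> proj UNIV. \<forall>p\<in>S. \<forall>v\<in>l. poly_eval p (($) v) = 0}"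

definition vanishing_ideal :: "(complex^'m) set set \<Rightarrow> 'm cpoly set" where
  "vanishing_ideal X = {p. \<forall>l\<in>X. \<forall>v\<in>l. poly_eval p (($) v) = 0}"

definition orbit ::
  "(complex^'n^'n) set \<Rightarrow> (complex^'n^'n \<Rightarrow> complex^'m^'m) \<Rightarrow> (complex^'m) set
     \<Rightarrow> (complex^'m) set set" where
  "orbit G \<rho> l = {(*v) (\<rho> g) ` l | g. g \<in> G}"

definition closed_orbit ::
  "(complex^'n^'n) set \<Rightarrow> (complex^'n^'n \<Rightarrow> complex^'m^'m) \<Rightarrow> (complex^'m) set set \<Rightarrow> bool" where
  "closed_orbit G \<rho> X \<longleftrightarrow> (\<exists>l\<in>proj UNIV. X = orbit G \<rho> l) \<and> closedin zariski_proj X"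

text \<open>For \<open>r = 0\<close> the union below is empty, so \<open>secant X 0 = {}\<close>.\<close>

definition secant :: "(complex^'m) set set \<Rightarrow> nat \<Rightarrow> (complex^'m) set set" where
  "secant X r = zariski_proj closure_of
     (\<Union>xs\<in>{xs. length xs = r \<and> set xs \<subseteq> X}. proj (vec.span (\<Union>(set xs))))"


section \<open>Invariants\<close>

definition invariants ::
  "(complex^'n^'n) set \<Rightarrow> (complex^'n^'n \<Rightarrow> complex^'m^'m) \<Rightarrow> 'm cpoly set" where
  "invariants G \<rho> = {p. \<forall>g\<in>G. \<forall>v. poly_eval p (($) (\<rho> g *v v)) = poly_eval p (($) v)}"

definition invariants_ge1 ::
  "(complex^'n^'n) set \<Rightarrow> (complex^'n^'n \<Rightarrow> complex^'m^'m) \<Rightarrow> 'm cpoly set" where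
  "invariants_ge1 G \<rho> = {p \<in> invariants G \<rho>. poly_eval p (\<lambda>_. 0) = 0}"

definition unstable_locus ::
  "(complex^'n^'n) set \<Rightarrow> (complex^'n^'n \<Rightarrow> complex^'m^'m) \<Rightarrow> (complex^'m) set set" where
  "unstable_locus G \<rho> = zero_locus (invariants_ge1 G \<rho>)"

definition admits_generator ::
  "(complex^'n^'n) set \<Rightarrow> (complex^'n^'n \<Rightarrow> complex^'m^'m) \<Rightarrow> nat \<Rightarrow> bool" where
  "admits_generator G \<rho> d \<longleftrightarrow> d > 0 \<and>
     \<not> invariants G \<rho> \<inter> homogeneous d
         \<subseteq> is_subring hull (\<Union>e\<in>{..<d}. invariants G \<rho> \<inter> homogeneous e)"

definition min_generator_degree ::
  "(complex^'n^'n) set \<Rightarrow> (complex^'n^'n \<Rightarrow> complex^'m^'m) \<Rightarrow> nat" where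
  "min_generator_degree G \<rho> = (LEAST d. admits_generator G \<rho> d)"


section \<open>Tensors over the dual space and prolongations\<close>

text \<open>A tensor over \<open>V*\<close> is given by its coefficients with respect to the words in the dual
  standard basis: \<open>T\<close> stands for the sum of \<open>T [i\<^sub>1, \<dots>, i\<^sub>k]\<close> times
  \<open>x i\<^sub>1 \<otimes> \<dots> \<otimes> x i\<^sub>k\<close> over all words.\<close>

type_synonym 'i tensor = "'i list \<Rightarrow> complex"

definition tensor_power :: "nat \<Rightarrow> 'i tensor set" where
  "tensor_power k = {T. \<forall>w. length w \<noteq> k \<longrightarrow> T w = 0}"

definition sym_tensors :: "nat \<Rightarrow> 'i tensor set" where
  "sym_tensors k = {T \<in> tensor_power k. \<forall>w w'. mset w = mset w' \<longrightarrow> T w = T w'}"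

definition tensor_mult :: "'i tensor \<Rightarrow> 'i tensor \<Rightarrow> 'i tensor" where
  "tensor_mult S T = (\<lambda>w. \<Sum>k\<le>length w. S (take k w) * T (drop k w))"

text \<open>For linear subspaces \<open>A\<close> and \<open>B\<close> of tensor powers, the subspace \<open>A \<otimes> B\<close> of the
  tensor algebra: finite sums of products.\<close>

definition tensor_space :: "'i tensor set \<Rightarrow> 'i tensor set \<Rightarrow> 'i tensor set" where
  "tensor_space A B = {\<lambda>w. \<Sum>i<N. tensor_mult (a i) (b i) w | (N::nat) a b.
     (\<forall>i<N. a i \<in> A \<and> b i \<in> B)}"

text \<open>The map from the tensor algebra to the polynomials sending \<open>x i\<^sub>1 \<otimes> \<dots> \<otimes> x i\<^sub>k\<close> to the
  monomial \<open>x i\<^sub>1 \<cdots> x i\<^sub>k\<close>. Restricted to \<open>sym_tensors k\<close> it is the identification of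
  \<open>S\<^sup>kV*\<close> with the polynomials of degree \<open>k\<close>: it sends \<open>T\<close> to
  \<open>v \<mapsto> T(v, \<dots>, v)\<close>.\<close>

definition tensor_poly :: "'i::finite tensor \<Rightarrow> 'i cpoly" where
  "tensor_poly T = (\<Sum>w | T w \<noteq> 0.
     Poly_Mapping.single (\<Sum>i\<leftarrow>w. Poly_Mapping.single i 1) (T w))"

text \<open>The degree 2 component of the ideal of \<open>X\<close> as a subspace of \<open>S\<^sup>2V*\<close>.\<close>

definition quadric_tensors :: "(complex^'m) set set \<Rightarrow> 'm tensor set" where
  "quadric_tensors X = {T \<in> sym_tensors 2. tensor_poly T \<in> vanishing_ideal X \<inter> homogeneous 2}"

text \<open>The \<open>k\<close>-th prolongation of a subspace \<open>W\<close> of \<open>S\<^sup>2V*\<close>.\<close>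

definition prolongation :: "nat \<Rightarrow> 'i tensor set \<Rightarrow> 'i tensor set" where
  "prolongation k W = tensor_space W (sym_tensors k) \<inter> sym_tensors (k + 2)"

end

(* Identify a homogeneous polynomial of degree d with its symmetric tensor T; contractions of T with
   vectors commute, and the value at v is T(v, ..., v). Write X^ for the cone over the closed orbit;
   it spans V because V is irreducible.

   (i) If a nonzero homogeneous invariant of degree d vanished on the spans of all d-tuples in X^,
   then the d-fold contractions of T with vectors of X^ would vanish, hence T = 0 since X^ spans V.
   So the d-th secant variety is not contained in the nullcone.

   (ii) Contracting an element of the prolongation twice with the same vector of X^ gives 0, so by
   the pigeonhole principle this polynomial of degree r + 1 vanishes on spans of r vectors of X^,
   thus on the r-th secant variety and on the nullcone. The Nullstellensatz then applies. *)

theory Submission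
  imports Defs "HOL-Computational_Algebra.Fundamental_Theorem_Algebra"
begin


section \<open>Evaluation\<close>

text \<open>The unstable locus consists of lines, while the Nullstellensatz speaks of points of V.
  The two agree because the zero set of the invariants vanishing at 0 is a cone, which rests on the
  invariance of homogeneous components. In (i) only values T(y, ..., y) with y in a span are known
  to vanish; differentiating along one spanning vector at a time extracts the mixed contractions, so
  d vectors suffice in degree d. The Nullstellensatz comes from cardinality: polynomials have
  countable dimension over an uncountable field, which forces the residues of the variables to be
  constants. Rabinowitsch's auxiliary variable is replaced by an ideal maximal among those avoiding
  all powers of f.\<close>

abbreviation lookup where "lookup \<equiv> Poly_Mapping.lookup"
abbreviation keys where "keys \<equiv> Poly_Mapping.keys"

definition mono_eval :: "('i::finite \<Rightarrow>\<^sub>0 nat) \<Rightarrow> ('i \<Rightarrow> complex) \<Rightarrow> complex" where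
  "mono_eval m x = (\<Prod>i\<in>UNIV. x i ^ lookup m i)"

lemma mono_eval_0 [simp]: "mono_eval 0 x = 1"
  by (simp add: mono_eval_def)

lemma mono_eval_add: "mono_eval (m + n) x = mono_eval m x * mono_eval n x"
  by (simp add: mono_eval_def lookup_add power_add prod.distrib)

lemma mono_eval_single [simp]: "mono_eval (Poly_Mapping.single i 1) x = x i"
proof -
  have "mono_eval (Poly_Mapping.single i 1) x = (\<Prod>j\<in>UNIV. if j = i then x j else 1)"
    unfolding mono_eval_def by (rule prod.cong) (auto simp: lookup_single when_def)
  then show ?thesis by simp
qed

lemma monomial_degree_UNIV: "monomial_degree (m :: 'i::finite \<Rightarrow>\<^sub>0 nat) = (\<Sum>i\<in>UNIV. lookup m i)"
  unfolding monomial_degree_def by (rule sum.mono_neutral_left) (auto simp: in_keys_iff)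

lemma monomial_degree_add:
  "monomial_degree (m + n :: 'i::finite \<Rightarrow>\<^sub>0 nat) = monomial_degree m + monomial_degree n"
  by (simp add: monomial_degree_UNIV lookup_add sum.distrib)

lemma monomial_degree_eq_0:
  "monomial_degree (m :: 'i::finite \<Rightarrow>\<^sub>0 nat) = 0 \<longleftrightarrow> m = 0"
  by (auto simp: monomial_degree_UNIV intro: poly_mapping_eqI)

lemma mono_eval_scale: "mono_eval m (\<lambda>i. t * x i) = t ^ monomial_degree m * mono_eval m x"
  by (simp add: mono_eval_def monomial_degree_UNIV power_mult_distrib prod.distrib power_sum)

lemma poly_eval_superset:
  fixes p :: "'i::finite cpoly"
  assumes "finite A" "keys p \<subseteq> A"
  shows "poly_eval p x = (\<Sum>m\<in>A. lookup p m * mono_eval m x)"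
proof -
  have "(\<Prod>i\<in>keys m. x i ^ lookup m i) = mono_eval m x" for m :: "'i \<Rightarrow>\<^sub>0 nat"
    unfolding mono_eval_def by (rule prod.mono_neutral_left) (auto simp: in_keys_iff)
  then have "poly_eval p x = (\<Sum>m\<in>keys p. lookup p m * mono_eval m x)"
    by (simp add: poly_eval_def)
  also have "\<dots> = (\<Sum>m\<in>A. lookup p m * mono_eval m x)"
    using assms by (intro sum.mono_neutral_left) (auto simp: in_keys_iff)
  finally show ?thesis .
qed

lemma poly_eval_keys:
  "poly_eval (p :: 'i::finite cpoly) x = (\<Sum>m\<in>keys p. lookup p m * mono_eval m x)"
  by (rule poly_eval_superset) auto

lemma poly_eval_0 [simp]: "poly_eval (0 :: 'i::finite cpoly) x = 0"
  by (simp add: poly_eval_def)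

lemma poly_eval_single [simp]:
  "poly_eval (Poly_Mapping.single m a :: 'i::finite cpoly) x = a * mono_eval m x"
  by (subst poly_eval_superset[where A = "{m}"]) (auto split: if_splits)

lemma poly_eval_add [simp]:
  "poly_eval (p + q :: 'i::finite cpoly) x = poly_eval p x + poly_eval q x"
proof -
  have "keys (p + q) \<subseteq> keys p \<union> keys q" by (rule keys_add)
  then show ?thesis
    by (simp add: poly_eval_superset[where A = "keys p \<union> keys q"] lookup_add
        distrib_right sum.distrib)
qed

lemma poly_eval_sum [simp]:
  "poly_eval (sum f A :: 'i::finite cpoly) x = (\<Sum>a\<in>A. poly_eval (f a) x)"
  by (induction A rule: infinite_finite_induct) auto

lemma poly_eval_homogeneous_scale:
  fixes p :: "'i::finite cpoly"
  assumes "p \<in> homogeneous d"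
  shows "poly_eval p (\<lambda>i. t * x i) = t ^ d * poly_eval p x"
  using assms
  by (auto simp: poly_eval_keys mono_eval_scale sum_distrib_left homogeneous_def
      intro!: sum.cong)

definition hcomp :: "nat \<Rightarrow> 'i::finite cpoly \<Rightarrow> 'i cpoly" where
  "hcomp d p = (\<Sum>m | m \<in> keys p \<and> monomial_degree m = d. Poly_Mapping.single m (lookup p m))"

lemma lookup_hcomp: "lookup (hcomp d p) m = (if monomial_degree m = d then lookup p m else 0)"
  by (auto simp: hcomp_def lookup_sum lookup_single when_def sum.If_cases in_keys_iff
      cong: if_cong)

lemma hcomp_homogeneous: "hcomp d p \<in> homogeneous d"
  by (auto simp: homogeneous_def in_keys_iff lookup_hcomp split: if_splits)

lemma sum_hcomp:
  assumes "monomial_degree ` keys p \<subseteq> D" "finite D"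
  shows "(\<Sum>d\<in>D. hcomp d p) = p"
proof (rule poly_mapping_eqI)
  fix m
  show "lookup (\<Sum>d\<in>D. hcomp d p) m = lookup p m"
    using assms by (cases "m \<in> keys p") (auto simp: lookup_sum lookup_hcomp in_keys_iff)
qed

section \<open>Homogeneous components of invariants\<close>

text \<open>As \<open>\<rho> g\<close> is linear, replacing v by t v turns invariance into a
  polynomial identity in t, whose coefficients are the differences for the single
  components.\<close>

lemma hcomp_invariant:
  fixes p :: "'m::finite cpoly"
  assumes "p \<in> invariants G \<rho>"
  shows "hcomp d p \<in> invariants G \<rho>"
  unfolding invariants_def
proof (intro CollectI ballI allI)
  fix g v
  assume g: "g \<in> G"
  \<comment> \<open>\<open>d\<close> is inserted so that \<open>c d\<close> is among the compared
    coefficients even when \<open>d\<close> exceeds every degree in \<open>p\<close>.\<close>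
  define N where "N = Max (insert d (monomial_degree ` keys p))"
  have D: "monomial_degree ` keys p \<subseteq> {..N}" "d \<le> N" by (auto simp: N_def)
  define c where "c i = poly_eval (hcomp i p) (($) (\<rho> g *v v)) - poly_eval (hcomp i p) (($) v)" for i
  have ev: "poly_eval p (($) (t *s u)) = (\<Sum>i\<le>N. poly_eval (hcomp i p) (($) u) * t ^ i)"
    for t and u :: "complex^'m"
  proof -
    have "poly_eval p (($) (t *s u)) = poly_eval (\<Sum>i\<le>N. hcomp i p) (\<lambda>j. t * u $ j)"
      using D by (subst sum_hcomp) (auto simp: fun_eq_iff intro!: arg_cong[where f = "poly_eval p"])
    also have "\<dots> = (\<Sum>i\<le>N. poly_eval (hcomp i p) (($) u) * t ^ i)"
      by (simp add: poly_eval_homogeneous_scale[OF hcomp_homogeneous] mult.commute)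
    finally show ?thesis .
  qed
  have "\<rho> g *v (t *s v) = t *s (\<rho> g *v v)" for t
    by (simp add: vec.scale)
  then have "(\<Sum>i\<le>N. c i * t ^ i) = 0" for t
    using assms g ev[of t v] ev[of t "\<rho> g *v v"]
    by (simp add: c_def left_diff_distrib sum_subtractf invariants_def) metis
  then have "c d = 0"
    using polyfun_eq_0[of c N] D by auto
  then show "poly_eval (hcomp d p) (($) (\<rho> g *v v)) = poly_eval (hcomp d p) (($) v)"
    by (simp add: c_def)
qed

lemma poly_eval_at_0:
  "poly_eval (p :: 'i::finite cpoly) (\<lambda>_. 0) = lookup p 0"
proof -
  have *: "mono_eval m (\<lambda>_. 0) = (if m = 0 then 1 else 0)" for m :: "'i \<Rightarrow>\<^sub>0 nat"
    using mono_eval_scale[of m 0 "\<lambda>_. 0"] monomial_degree_eq_0[of m]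
    by (cases "monomial_degree m = 0") (auto simp: power_0_left)
  have "poly_eval p (\<lambda>_. 0) = (\<Sum>m\<in>insert 0 (keys p). lookup p m * mono_eval m (\<lambda>_. 0))"
    by (rule poly_eval_superset) auto
  also have "\<dots> = (\<Sum>m\<in>insert 0 (keys p). if m = 0 then lookup p m else 0)"
    by (rule sum.cong) (auto simp: *)
  finally show ?thesis by simp
qed

lemma homogeneous_in_invariants_ge1:
  fixes p :: "'m::finite cpoly"
  assumes "p \<in> invariants G \<rho>" "p \<in> homogeneous d" "d > 0"
  shows "p \<in> invariants_ge1 G \<rho>"
proof -
  have "monomial_degree (0 :: 'm \<Rightarrow>\<^sub>0 nat) = 0" by (simp add: monomial_degree_eq_0)
  then have "0 \<notin> keys p" using assms(2,3) by (auto simp: homogeneous_def)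
  then have "lookup p 0 = 0" by (simp add: in_keys_iff)
  then show ?thesis using assms by (simp add: invariants_ge1_def poly_eval_at_0)
qed

text \<open>Although \<open>p\<close> may be inhomogeneous, its components of positive degree are
  again in \<open>invariants_ge1\<close>, so they vanish at \<open>v\<close> one by one. Points of
  \<open>unstable_locus\<close> require vanishing on a whole line.\<close>

lemma zero_set_invariants_ge1_scale:
  fixes v :: "complex^'m"
  assumes v: "\<forall>p\<in>invariants_ge1 G \<rho>. poly_eval p (($) v) = 0"
    and p: "p \<in> invariants_ge1 G \<rho>"
  shows "poly_eval p (($) (t *s v)) = 0"
proof -
  have "poly_eval (hcomp d p) (($) (t *s v)) = 0" for d
  proof (cases "d = 0")
    case True
    have "hcomp 0 p = 0"
      using p by (intro poly_mapping_eqI)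
        (auto simp: lookup_hcomp monomial_degree_eq_0 invariants_ge1_def poly_eval_at_0)
    then show ?thesis using True by simp
  next
    case False
    then have "hcomp d p \<in> invariants_ge1 G \<rho>"
      using p by (intro homogeneous_in_invariants_ge1[of _ _ _ d] hcomp_invariant hcomp_homogeneous)
        (auto simp: invariants_ge1_def)
    then show ?thesis
      using v poly_eval_homogeneous_scale[OF hcomp_homogeneous, of d p t "($) v"]
      by (simp add: vector_scalar_mult_def vec_lambda_inverse)
  qed
  then have "poly_eval (\<Sum>d\<in>monomial_degree ` keys p. hcomp d p) (($) (t *s v)) = 0"
    by simp
  then show ?thesis by (subst (asm) sum_hcomp) auto
qed

section \<open>Constants and the least degree of a generator\<close>

lemma const_poly_simps:
  "const_poly a - const_poly b = const_poly (a - b)"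
  "const_poly a * const_poly b = const_poly (a * b)"
  "const_poly a + const_poly b = const_poly (a + b)"
  "const_poly 1 = 1" "const_poly 0 = 0"
  by (auto simp: const_poly_def single_diff mult_single single_add)

lemma homogeneous_0: "homogeneous 0 = (range const_poly :: 'i::finite cpoly set)"
proof (intro equalityI subsetI)
  fix p :: "'i cpoly"
  assume "p \<in> homogeneous 0"
  then have "lookup p m = lookup (const_poly (lookup p 0)) m" for m
    by (auto simp: homogeneous_def monomial_degree_eq_0 const_poly_def lookup_single when_def in_keys_iff)
  then have "p = const_poly (lookup p 0)" by (rule poly_mapping_eqI)
  then show "p \<in> range const_poly" by blast
qed (auto simp: homogeneous_def const_poly_def monomial_degree_eq_0 split: if_splits)

lemma const_poly_invariant: "const_poly c \<in> invariants G (\<rho> :: _ \<Rightarrow> complex^'m^'m)"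
  by (simp add: invariants_def const_poly_def)

text \<open>In the least positive degree of a nonzero homogeneous invariant, everything of lower
  degree is constant and generates only constants. Without such a degree the \<open>LEAST\<close> in
  \<open>min_generator_degree\<close> would be arbitrary.\<close>

lemma ex_admits_generator:
  fixes \<rho> :: "complex^'n^'n \<Rightarrow> complex^'m^'m"
  assumes "invariants G \<rho> \<noteq> range const_poly"
  shows "\<exists>d. admits_generator G \<rho> d"
proof -
  obtain p where p: "p \<in> invariants G \<rho>" "p \<notin> range const_poly"
    using assms const_poly_invariant[of _ G \<rho>] by auto
  then obtain m where m: "m \<in> keys p" "monomial_degree m \<noteq> 0"
    unfolding homogeneous_0[symmetric] by (auto simp: homogeneous_def)
  define P where "P d \<longleftrightarrow> d > 0 \<and> (\<exists>q\<in>invariants G \<rho> \<inter> homogeneous d. q \<noteq> 0)" for d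
  have "lookup (hcomp (monomial_degree m) p) m \<noteq> 0"
    using m by (simp add: lookup_hcomp in_keys_iff)
  then have "hcomp (monomial_degree m) p \<noteq> 0" by auto
  then have "P (monomial_degree m)"
    using m p hcomp_invariant[of p G \<rho>] hcomp_homogeneous[of _ p] by (auto simp: P_def)
  then have P: "P (LEAST d. P d)" and less: "\<And>e. e < (LEAST d. P d) \<Longrightarrow> \<not> P e"
    by (auto intro: LeastI dest: not_less_Least)
  define d where "d = (LEAST d. P d)"
  obtain q where q: "q \<in> invariants G \<rho>" "q \<in> homogeneous d" "q \<noteq> 0" "d > 0"
    using P by (auto simp: P_def d_def)
  have "(\<Union>e\<in>{..<d}. invariants G \<rho> \<inter> homogeneous e) \<subseteq> range const_poly"
  proof safe
    fix e u
    assume u: "e < d" "u \<in> invariants G \<rho>" "u \<in> homogeneous e"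
    show "u \<in> range const_poly"
    proof (cases "e = 0")
      case True
      then show ?thesis using u homogeneous_0 by blast
    next
      case False
      then have "u = 0" using less[of e] u by (auto simp: P_def d_def)
      then show ?thesis by (metis const_poly_simps(5) rangeI)
    qed
  qed
  moreover have "is_subring (range const_poly :: 'm cpoly set)"
    unfolding is_subring_def
    using const_poly_simps(4)[symmetric] by (auto simp: const_poly_simps(1,2))
  ultimately have "is_subring hull (\<Union>e\<in>{..<d}. invariants G \<rho> \<inter> homogeneous e) \<subseteq> range const_poly"
    by (rule hull_minimal)
  moreover have "q \<notin> range const_poly"
    using q unfolding homogeneous_0[symmetric]
    by (auto simp: homogeneous_def)
  ultimately have "admits_generator G \<rho> d"
    using q by (auto simp: admits_generator_def)
  then show ?thesis ..
qed

lemma min_generator_invariant: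
  fixes \<rho> :: "complex^'n^'n \<Rightarrow> complex^'m^'m"
  assumes "invariants G \<rho> \<noteq> range const_poly"
  obtains f where "f \<in> invariants G \<rho>" "f \<in> homogeneous (min_generator_degree G \<rho>)" "f \<noteq> 0"
    "min_generator_degree G \<rho> > 0"
proof -
  have "admits_generator G \<rho> (min_generator_degree G \<rho>)"
    unfolding min_generator_degree_def using ex_admits_generator[OF assms] by (rule LeastI_ex)
  then obtain f where f: "min_generator_degree G \<rho> > 0" "f \<in> invariants G \<rho>"
      "f \<in> homogeneous (min_generator_degree G \<rho>)"
      "f \<notin> is_subring hull (\<Union>e\<in>{..<min_generator_degree G \<rho>}. invariants G \<rho> \<inter> homogeneous e)"
    by (auto simp: admits_generator_def)
  \<comment> \<open>The generated subring contains 0, and \<open>f\<close> lies outside it.\<close>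
  have "0 \<in> R" if "is_subring R" for R :: "'m cpoly set"
    using that unfolding is_subring_def by (metis diff_self)
  then have "f \<noteq> 0" using f(4) by (auto simp: hull_def)
  with f that show thesis by blast
qed


section \<open>Hilbert's Nullstellensatz over the complex numbers\<close>

lemma is_ideal_diff: "is_ideal I \<Longrightarrow> a \<in> I \<Longrightarrow> b \<in> I \<Longrightarrow> a - b \<in> I"
  unfolding is_ideal_def by (metis add_uminus_conv_diff mult_minus1)

lemma is_ideal_mult: "is_ideal I \<Longrightarrow> b \<in> I \<Longrightarrow> a * b \<in> I"
  by (simp add: is_ideal_def)

lemma is_ideal_sum: "is_ideal I \<Longrightarrow> (\<And>x. x \<in> A \<Longrightarrow> f x \<in> I) \<Longrightarrow> sum f A \<in> I"
  by (induction A rule: infinite_finite_induct) (auto simp: is_ideal_def)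

lemma is_ideal_hull: "is_ideal (is_ideal hull S)"
  by (rule hull_in) (auto simp: is_ideal_def)

text \<open>\<open>M\<close> is the contraction of a maximal ideal of the localization at
  \<open>f\<close>: elements outside \<open>M\<close> become invertible modulo \<open>M\<close> once
  \<open>f\<close> is inverted.\<close>

lemma ex_maximal_ideal_avoiding_powers:
  fixes f :: "'a::comm_ring_1"
  assumes I: "is_ideal I" "f \<notin> ideal_radical I"
  obtains M where "is_ideal M" "I \<subseteq> M" "\<forall>k. f ^ k \<notin> M"
    "\<forall>a. a \<notin> M \<longrightarrow> (\<exists>k b. f ^ k - a * b \<in> M)"
proof -
  define \<A> where "\<A> = {A. is_ideal A \<and> I \<subseteq> A \<and> (\<forall>k. f ^ k \<notin> A)}"
  \<comment> \<open>\<open>ideal_radical\<close> asks for a positive exponent; one more factor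
    \<open>f\<close> covers \<open>k = 0\<close>.\<close>
  have "f ^ k \<notin> I" for k
  proof
    assume k: "f ^ k \<in> I"
    then have "f ^ Suc k \<in> I" using is_ideal_mult[OF I(1) k, of f] by simp
    then show False using I(2) unfolding ideal_radical_def by blast
  qed
  then have "\<A> \<noteq> {}" using I by (auto simp: \<A>_def)
  moreover have "\<Union>\<C> \<in> \<A>" if \<C>: "\<C> \<noteq> {}" "subset.chain \<A> \<C>" for \<C>
  proof -
    have A: "\<And>A. A \<in> \<C> \<Longrightarrow> is_ideal A \<and> I \<subseteq> A \<and> (\<forall>k. f ^ k \<notin> A)"
      using \<C>(2) by (auto simp: subset.chain_def \<A>_def)
    have sum: "a + b \<in> \<Union>\<C>" if ab: "a \<in> A" "A \<in> \<C>" "b \<in> B" "B \<in> \<C>" for a b A B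
    proof -
      have "A \<subseteq> B \<or> B \<subseteq> A" using \<C>(2) ab unfolding subset.chain_def by blast
      then obtain C where "C \<in> \<C>" "a \<in> C" "b \<in> C" using ab by blast
      then show ?thesis using A[of C] by (auto simp: is_ideal_def)
    qed
    obtain A\<^sub>0 where A\<^sub>0: "A\<^sub>0 \<in> \<C>" using \<C>(1) by blast
    have "is_ideal (\<Union>\<C>)"
      unfolding is_ideal_def
    proof (intro conjI ballI allI)
      show "0 \<in> \<Union>\<C>" using A[OF A\<^sub>0] A\<^sub>0 by (auto simp: is_ideal_def)
      show "a * b \<in> \<Union>\<C>" if "b \<in> \<Union>\<C>" for a b
        using that A is_ideal_mult by (metis Union_iff)
    qed (use sum in blast)
    moreover have "I \<subseteq> \<Union>\<C>" using A[OF A\<^sub>0] A\<^sub>0 by blast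
    ultimately show ?thesis using A by (auto simp: \<A>_def)
  qed
  ultimately obtain M where M: "M \<in> \<A>" and max: "\<And>A. A \<in> \<A> \<Longrightarrow> M \<subseteq> A \<Longrightarrow> A = M"
    using subset_Zorn_nonempty[of \<A>] by blast
  have idM: "is_ideal M" using M by (simp add: \<A>_def)
  have "\<exists>k b. f ^ k - a * b \<in> M" if a: "a \<notin> M" for a
  proof -
    \<comment> \<open>The ideal generated by \<open>M\<close> and \<open>a\<close>; by maximality it
      contains a power of \<open>f\<close>.\<close>
    define A where "A = {y. \<exists>b. y - a * b \<in> M}"
    have "is_ideal A"
      unfolding is_ideal_def
    proof (intro conjI ballI allI)
      show "0 \<in> A" using idM by (auto simp: A_def is_ideal_def intro: exI[of _ 0])
    next
      fix x y assume "x \<in> A" "y \<in> A"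
      then obtain b c where "x - a * b \<in> M" "y - a * c \<in> M" by (auto simp: A_def)
      then have "(x - a * b) + (y - a * c) \<in> M" using idM by (simp add: is_ideal_def)
      then have "(x + y) - a * (b + c) \<in> M" by (simp add: algebra_simps)
      then show "x + y \<in> A" by (auto simp: A_def)
    next
      fix c x assume "x \<in> A"
      then obtain b where "x - a * b \<in> M" by (auto simp: A_def)
      then have "c * (x - a * b) \<in> M" by (rule is_ideal_mult[OF idM])
      then have "c * x - a * (c * b) \<in> M" by (simp add: algebra_simps)
      then show "c * x \<in> A" by (auto simp: A_def)
    qed
    moreover have "M \<subseteq> A" by (auto simp: A_def intro!: exI[of _ 0])
    moreover have "a \<in> A" using idM by (auto simp: A_def is_ideal_def intro!: exI[of _ 1])
    ultimately have "A \<notin> \<A>" using max a by blast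
    then show ?thesis using \<open>is_ideal A\<close> \<open>M \<subseteq> A\<close> M by (auto simp: \<A>_def A_def)
  qed
  then show thesis using M that[of M] by (auto simp: \<A>_def)
qed

text \<open>Otherwise both factors, and with them their product, would be units up to powers of
  \<open>f\<close>, which puts a power of \<open>f\<close> into \<open>M\<close>.\<close>

lemma maximal_avoiding_prime:
  fixes f :: "'a::comm_ring_1"
  assumes M: "is_ideal M" "\<forall>k. f ^ k \<notin> M"
    and max: "\<forall>a. a \<notin> M \<longrightarrow> (\<exists>k b. f ^ k - a * b \<in> M)"
    and ab: "a * b \<in> M"
  shows "a \<in> M \<or> b \<in> M"
proof (rule ccontr)
  assume "\<not> ?thesis"
  then obtain k c l d where "f ^ k - a * c \<in> M" "f ^ l - b * d \<in> M" using max by meson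
  then have "f ^ l * (f ^ k - a * c) + a * c * (f ^ l - b * d) + c * d * (a * b) \<in> M"
    using M(1) ab by (simp add: is_ideal_def)
  then have "f ^ (k + l) \<in> M" by (simp add: algebra_simps power_add)
  then show False using M(2) by blast
qed

section \<open>Countable dimension and linear relations\<close>

lemma countable_exponents: "countable (UNIV :: ('i::finite \<Rightarrow>\<^sub>0 nat) set)"
  by (rule countableI'[of "\<lambda>m. to_nat (lookup m)"])
    (auto intro!: injI simp: poly_mapping.lookup_inject)

interpretation cpoly: vector_space "\<lambda>c (p :: 'i cpoly). const_poly c * p"
  by unfold_locales
    (simp_all add: algebra_simps const_poly_simps(4) flip: const_poly_simps(2,3))

lemma sum_monomials: "p = (\<Sum>m\<in>keys p. const_poly (lookup p m) * Poly_Mapping.single m 1)"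
  by (rule poly_mapping_eqI)
    (simp add: const_poly_def mult_single lookup_sum lookup_single when_def in_keys_iff)

lemma cpoly_in_span_monomials:
  assumes "keys p \<subseteq> F"
  shows "p \<in> cpoly.span ((\<lambda>m. Poly_Mapping.single m 1) ` F)"
proof -
  have "p = (\<Sum>m\<in>keys p. const_poly (lookup p m) * Poly_Mapping.single m 1)"
    by (rule sum_monomials)
  also have "\<dots> \<in> cpoly.span ((\<lambda>m. Poly_Mapping.single m 1) ` F)"
    using assms by (intro cpoly.span_sum cpoly.span_scale cpoly.span_base) auto
  finally show ?thesis .
qed

text \<open>Linear dependence is a notion for sets, not families. If \<open>b\<close> is injective
  on \<open>C\<close>, its infinite image lies in a finite dimensional space; if not, two indices
  with equal values give a relation with coefficients 1 and -1.\<close>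

lemma ex_linear_relation:
  fixes b :: "complex \<Rightarrow> 'i cpoly"
  assumes F: "finite F" and C: "infinite C" and b: "\<forall>c\<in>C. keys (b c) \<subseteq> F"
  obtains S a c0 where "finite S" "S \<subseteq> C" "(\<Sum>c\<in>S. const_poly (a c) * b c) = 0"
    "c0 \<in> S" "a c0 \<noteq> 0"
proof (cases "inj_on b C")
  case True
  then have "infinite (b ` C)" using C finite_imageD by blast
  moreover have "b ` C \<subseteq> cpoly.span ((\<lambda>m. Poly_Mapping.single m 1) ` F)"
    using b cpoly_in_span_monomials by blast
  ultimately have "cpoly.dependent (b ` C)"
    using cpoly.independent_span_bound[of "(\<lambda>m. Poly_Mapping.single m 1) ` F" "b ` C"] F by blast
  then obtain t u v where t: "finite t" "t \<subseteq> b ` C" "(\<Sum>v\<in>t. const_poly (u v) * v) = 0"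
      "v \<in> t" "u v \<noteq> 0"
    unfolding cpoly.dependent_explicit by blast
  then obtain S where S: "S \<subseteq> C" "finite S" "t = b ` S"
    using finite_subset_image[OF t(1,2)] by blast
  have "(\<Sum>c\<in>S. const_poly (u (b c)) * b c) = 0"
    using t(3) True S by (simp add: S(3) sum.reindex inj_on_subset)
  moreover obtain c0 where "c0 \<in> S" "v = b c0" using t(4) S(3) by blast
  ultimately show thesis using S t(5) by (intro that[of S "\<lambda>c. u (b c)" c0]) auto
next
  case False
  then obtain x y where xy: "x \<in> C" "y \<in> C" "x \<noteq> y" "b x = b y" by (auto simp: inj_on_def)
  then have "(\<Sum>c\<in>{x,y}. const_poly (if c = x then 1 else -1) * b c) = const_poly (1 + -1) * b x"
    by (simp only: const_poly_simps(3)[symmetric]) (simp add: distrib_right)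
  then have "(\<Sum>c\<in>{x,y}. const_poly (if c = x then 1 else -1) * b c) = 0"
    by (simp add: const_poly_simps)
  then show thesis using xy by (intro that[of "{x,y}" "\<lambda>c. if c = x then 1 else -1" x]) auto
qed

section \<open>Substitution into univariate polynomials and residues modulo a prime\<close>

definition poly_at :: "complex poly \<Rightarrow> 'i cpoly \<Rightarrow> 'i cpoly" where
  "poly_at q x = poly (map_poly const_poly q) x"

lemma poly_at_add:
  fixes x :: "'i cpoly"
  shows "poly_at (p + q) x = poly_at p x + poly_at q x"
proof -
  have "map_poly const_poly (p + q)
      = map_poly const_poly p + (map_poly const_poly q :: 'i cpoly poly)"
    by (rule poly_eqI) (simp add: coeff_map_poly const_poly_simps)
  then show ?thesis by (simp add: poly_at_def)
qed

lemma poly_at_smult: "poly_at (smult a p) x = const_poly a * poly_at p x"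
  by (simp add: poly_at_def map_poly_smult const_poly_simps)

lemma poly_at_0 [simp]: "poly_at 0 x = 0"
  by (simp add: poly_at_def)

lemma poly_at_pCons: "poly_at (pCons a p) x = const_poly a + x * poly_at p x"
  by (simp add: poly_at_def map_poly_pCons const_poly_simps)

lemma poly_at_mult: "poly_at (p * q) x = poly_at p x * poly_at q x"
  by (induction p)
    (simp_all add: poly_at_pCons poly_at_add poly_at_smult const_poly_simps algebra_simps)

lemma poly_at_sum: "poly_at (sum g S) x = (\<Sum>s\<in>S. poly_at (g s) x)"
  by (induction S rule: infinite_finite_induct) (simp_all add: poly_at_add)

lemma poly_at_1: "poly_at 1 x = 1"
  by (simp add: poly_at_pCons const_poly_simps one_pCons)

lemma poly_at_prod: "poly_at (prod g S) x = (\<Prod>s\<in>S. poly_at (g s) x)"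
  by (induction S rule: infinite_finite_induct) (simp_all add: poly_at_mult poly_at_1)

lemma const_poly_uminus: "const_poly (- c) = - const_poly c"
  by (simp add: eq_neg_iff_add_eq_0 const_poly_simps)

lemma poly_at_linear: "poly_at [:- c, 1:] x = x - const_poly c"
  by (simp add: poly_at_pCons const_poly_simps const_poly_uminus)

text \<open>Over an algebraically closed field \<open>q\<close> splits into linear factors, and the
  prime \<open>M\<close> must contain one of them after substitution, since it contains no nonzero
  constant.\<close>

lemma prime_ideal_root:
  fixes M :: "'i cpoly set"
  assumes M: "is_ideal M" "1 \<notin> M" "\<And>a b. a * b \<in> M \<Longrightarrow> a \<in> M \<or> b \<in> M"
  shows "q \<noteq> 0 \<Longrightarrow> poly_at q x \<in> M \<Longrightarrow> \<exists>c. x - const_poly c \<in> M"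
proof (induction "degree q" arbitrary: q)
  case 0
  then obtain a where a: "q = [:a:]" "a \<noteq> 0" by (auto elim: degree_eq_zeroE)
  then have "const_poly (1 / a) * const_poly a \<in> M"
    using 0 by (intro is_ideal_mult[OF M(1)]) (simp add: poly_at_pCons)
  then show ?case using a M(2) by (simp add: const_poly_simps)
next
  case (Suc n)
  then obtain z where "poly q z = 0"
    using alg_closed_imp_poly_has_root[of q] by auto
  then obtain p where p: "q = [:- z, 1:] * p" by (auto simp: poly_eq_0_iff_dvd elim: dvdE)
  then have "p \<noteq> 0" using Suc.prems by auto
  then have "degree q = Suc (degree p)" unfolding p by (subst degree_mult_eq) auto
  then have deg: "n = degree p" using Suc.hyps by simp
  have "x - const_poly z \<in> M \<or> poly_at p x \<in> M"
    using Suc.prems(2) M(3) by (simp only: p poly_at_mult poly_at_linear)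
  then show ?case using Suc.hyps(1)[OF deg \<open>p \<noteq> 0\<close>] by blast
qed

text \<open>The elements \<open>b c\<close> are inverses of \<open>x - c\<close> up to powers of \<open>f\<close> modulo \<open>M\<close>. As the
  polynomial ring has countable dimension, they satisfy a linear relation; clearing denominators
  turns it into a univariate equation for \<open>x\<close> modulo \<open>M\<close>.\<close>

lemma maximal_avoiding_residue:
  fixes f x :: "'i::finite cpoly"
  assumes M: "is_ideal M" "\<forall>k. f ^ k \<notin> M"
    and max: "\<forall>a. a \<notin> M \<longrightarrow> (\<exists>k b. f ^ k - a * b \<in> M)"
  shows "\<exists>c. x - const_poly c \<in> M"
proof (rule ccontr)
  assume no: "\<not> ?thesis"
  have prime: "a \<in> M \<or> b \<in> M" if "a * b \<in> M" for a b
    by (rule maximal_avoiding_prime[OF M max that])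
  have one: "1 \<notin> M" using spec[OF M(2), of 0] by simp
  have "\<exists>k b. f ^ k - (x - const_poly c) * b \<in> M" for c
    using no max by blast
  then obtain k b where b: "\<And>c. f ^ k c - (x - const_poly c) * b c \<in> M" by metis
  \<comment> \<open>Only countably many pairs of an exponent and a finite support exist, so one
    class is uncountable. On it the power of \<open>f\<close> is constant and all \<open>b c\<close>
    lie in one finite dimensional space.\<close>
  define D where "D = (\<lambda>(n, F). {c. k c = n \<and> keys (b c) = F})"
  have "countable {F :: ('i \<Rightarrow>\<^sub>0 nat) set. finite F}"
    using countable_Collect_finite_subset[OF countable_exponents] by simp
  then have "countable (UNIV \<times> {F :: ('i \<Rightarrow>\<^sub>0 nat) set. finite F} :: (nat \<times> _) set)"
    by (intro countable_SIGMA) auto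
  moreover have "(\<Union>i\<in>UNIV \<times> {F. finite F}. D i) = UNIV"
    by (auto simp: D_def)
  ultimately obtain i where i: "i \<in> UNIV \<times> {F. finite F}" "uncountable (D i)"
    using uncountable_UNIV_complex by (metis countable_UN)
  obtain n F where nF: "i = (n, F)" "finite F" using i(1) by auto
  define C where "C = D i"
  have inf: "infinite C" using i(2) countable_finite by (auto simp: C_def)
  have C: "k c = n" "keys (b c) \<subseteq> F" if "c \<in> C" for c
    using that by (auto simp: C_def D_def nF)
  then have keys: "\<forall>c\<in>C. keys (b c) \<subseteq> F" by blast
  obtain S a c0 where S: "finite S" "S \<subseteq> C" "(\<Sum>c\<in>S. const_poly (a c) * b c) = 0"
      "c0 \<in> S" "a c0 \<noteq> 0"
    by (rule ex_linear_relation[OF nF(2) inf keys])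
  \<comment> \<open>The sum of all a(c) / (t - c), multiplied by the product of all t - c. At
    \<open>c0\<close> only the summand of \<open>c0\<close> survives, so \<open>q\<close> is
    nonzero.\<close>
  define q where "q = (\<Sum>c\<in>S. smult (a c) (\<Prod>l\<in>S - {c}. [:- l, 1:]))"
  have "poly q c0 = (\<Sum>c\<in>S. if c = c0 then a c * (\<Prod>l\<in>S - {c}. c0 - l) else 0)"
    unfolding q_def poly_sum poly_smult poly_prod
  proof (rule sum.cong)
    fix c assume "c \<in> S"
    then show "a c * (\<Prod>l\<in>S - {c}. poly [:- l, 1:] c0)
        = (if c = c0 then a c * (\<Prod>l\<in>S - {c}. c0 - l) else 0)"
      using S(1,4) by (auto simp: prod_zero_iff)
  qed simp
  also have "\<dots> = a c0 * (\<Prod>l\<in>S - {c0}. c0 - l)" using S by simp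
  also have "\<dots> \<noteq> 0" using S by (auto simp: prod_zero_iff)
  finally have "q \<noteq> 0" by auto
  define P where "P c = (\<Prod>l\<in>S - {c}. x - const_poly l)" for c
  \<comment> \<open>The first sum lies in \<open>M\<close> by the choice of \<open>b\<close>; the
    second has the linear relation as a factor.\<close>
  have "f ^ n * poly_at q x
      = (\<Sum>c\<in>S. const_poly (a c) * P c * (f ^ n - (x - const_poly c) * b c))
        + (\<Sum>c\<in>S. const_poly (a c) * b c * ((x - const_poly c) * P c))"
    by (simp add: q_def poly_at_sum poly_at_smult poly_at_prod poly_at_linear P_def
        sum_distrib_left sum.distrib[symmetric] algebra_simps)
  also have "(\<Sum>c\<in>S. const_poly (a c) * b c * ((x - const_poly c) * P c))
      = (\<Sum>c\<in>S. const_poly (a c) * b c) * (\<Prod>l\<in>S. x - const_poly l)"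
    unfolding sum_distrib_right P_def
    by (rule sum.cong) (use S in \<open>auto simp: prod.remove\<close>)
  also have "\<dots> = 0" using S(3) by simp
  also have "(\<Sum>c\<in>S. const_poly (a c) * P c * (f ^ n - (x - const_poly c) * b c)) + 0 \<in> M"
    using C b S(2) by (simp, intro is_ideal_sum[OF M(1)] is_ideal_mult[OF M(1)]) (metis subsetD)
  finally have "poly_at q x \<in> M" using prime M(2) by blast
  then show False using prime_ideal_root[OF M(1) one prime \<open>q \<noteq> 0\<close>] no by blast
qed

text \<open>Congruence to a constant respects products and linear combinations, so it passes from
  the variables to monomials and then to all polynomials.\<close>

lemma cpoly_cong_eval:
  fixes M :: "'i::finite cpoly set"
  assumes M: "is_ideal M" and c: "\<And>i. Poly_Mapping.single (Poly_Mapping.single i 1) 1 - const_poly (c i) \<in> M"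
  shows "p - const_poly (poly_eval p c) \<in> M"
proof -
  define R where "R = {(u, z). u - const_poly z \<in> M}"
  have mult: "(u * v, y * z) \<in> R" if "(u, y) \<in> R" "(v, z) \<in> R" for u v y z
  proof -
    have "v * (u - const_poly y) + const_poly y * (v - const_poly z) \<in> M"
      using that M by (auto simp: R_def is_ideal_def)
    then show ?thesis by (simp add: R_def algebra_simps const_poly_simps)
  qed
  have one: "(1, 1) \<in> R" using M by (simp add: R_def const_poly_simps is_ideal_def)
  have pow: "(u ^ n, y ^ n) \<in> R" if "(u, y) \<in> R" for u y n
    by (induction n) (use that one mult in auto)
  have mono: "(Poly_Mapping.single m 1, mono_eval m c) \<in> R" for m
  proof -
    have single: "Poly_Mapping.single (Poly_Mapping.single i 1) (1::complex) ^ n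
        = Poly_Mapping.single (Poly_Mapping.single i n) 1" for i :: 'i and n :: nat
      by (induction n) (simp_all add: mult_single single_add[symmetric] flip: single_one)
    have "m = (\<Sum>i\<in>UNIV. Poly_Mapping.single i (lookup m i))"
      by (rule poly_mapping_eqI) (simp add: lookup_sum lookup_single when_def)
    moreover have "(\<Prod>i\<in>A. Poly_Mapping.single (Poly_Mapping.single i (lookup m i)) (1::complex))
        = Poly_Mapping.single (\<Sum>i\<in>A. Poly_Mapping.single i (lookup m i)) 1" if "finite A" for A
      using that by (induction A) (simp_all add: mult_single)
    ultimately have m: "Poly_Mapping.single m 1
        = (\<Prod>i\<in>UNIV. Poly_Mapping.single (Poly_Mapping.single i 1) (1::complex) ^ lookup m i)"
      unfolding single by (metis finite_code)
    have "((\<Prod>i\<in>A. Poly_Mapping.single (Poly_Mapping.single i 1) 1 ^ lookup m i), 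
        \<Prod>i\<in>A. c i ^ lookup m i) \<in> R" if "finite A" for A
      using that
    proof (induction A)
      case (insert i A)
      then show ?case using mult[OF pow[of _ "c i"] insert.IH] c by (simp add: R_def)
    qed (use one in auto)
    then show ?thesis by (simp add: m mono_eval_def)
  qed
  have "p - const_poly (poly_eval p c)
      = (\<Sum>m\<in>keys p. const_poly (lookup p m) * (Poly_Mapping.single m 1 - const_poly (mono_eval m c)))"
  proof -
    have "const_poly (\<Sum>m\<in>A. g m) = (\<Sum>m\<in>A. const_poly (g m))" for A and g :: "('i \<Rightarrow>\<^sub>0 nat) \<Rightarrow> complex"
      by (induction A rule: infinite_finite_induct) (simp_all add: const_poly_simps flip: const_poly_simps(3))
    then have "const_poly (poly_eval p c)
        = (\<Sum>m\<in>keys p. const_poly (lookup p m) * const_poly (mono_eval m c))"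
      by (simp add: poly_eval_keys const_poly_simps)
    moreover have "p = (\<Sum>m\<in>keys p. const_poly (lookup p m) * Poly_Mapping.single m 1)"
      by (rule sum_monomials)
    ultimately show ?thesis by (simp add: right_diff_distrib sum_subtractf)
  qed
  also have "\<dots> \<in> M"
    using mono by (intro is_ideal_sum[OF M] is_ideal_mult[OF M]) (simp add: R_def)
  finally show ?thesis .
qed

text \<open>The residues of the variables modulo \<open>M\<close> form a point \<open>c\<close>. An
  element of \<open>S\<close> with nonzero value at \<open>c\<close> would put a nonzero constant
  into \<open>M\<close>; so \<open>c\<close> is a common zero, \<open>f\<close> vanishes there, and
  \<open>f\<close> itself would lie in \<open>M\<close>.\<close>

theorem nullstellensatz:
  fixes S :: "'i::finite cpoly set"
  assumes "\<And>x. (\<forall>p\<in>S. poly_eval p x = 0) \<Longrightarrow> poly_eval f x = 0"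
  shows "f \<in> ideal_radical (is_ideal hull S)"
proof (rule ccontr)
  assume "\<not> ?thesis"
  then obtain M where M: "is_ideal M" "is_ideal hull S \<subseteq> M" "\<forall>k. f ^ k \<notin> M"
    and max: "\<forall>a. a \<notin> M \<longrightarrow> (\<exists>k b. f ^ k - a * b \<in> M)"
    using ex_maximal_ideal_avoiding_powers[OF is_ideal_hull] by metis
  have "\<exists>c. \<forall>i. Poly_Mapping.single (Poly_Mapping.single i 1) 1 - const_poly (c i) \<in> M"
    by (intro choice allI maximal_avoiding_residue[OF M(1,3) max])
  then obtain c where c: "\<And>i. Poly_Mapping.single (Poly_Mapping.single i 1) 1 - const_poly (c i) \<in> M"
    by blast
  note eval = cpoly_cong_eval[OF M(1) c]
  have "poly_eval p c = 0" if p: "p \<in> S" for p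
  proof (rule ccontr)
    assume nz: "poly_eval p c \<noteq> 0"
    have "p \<in> M" using p M(2) hull_subset[of S is_ideal] by blast
    then have "p - (p - const_poly (poly_eval p c)) \<in> M" by (rule is_ideal_diff[OF M(1) _ eval])
    then have "const_poly (1 / poly_eval p c) * const_poly (poly_eval p c) \<in> M"
      by (intro is_ideal_mult[OF M(1)]) simp
    then show False using nz spec[OF M(3), of 0] by (simp add: const_poly_simps)
  qed
  then have "poly_eval f c = 0" by (intro assms) auto
  then show False using eval[of f] spec[OF M(3), of 1] by (simp add: const_poly_simps)
qed


section \<open>Contraction of tensors\<close>

text \<open>Interior product in the first slot. As tensors are defined on words of every length,
  contractions can be iterated within one type; \<open>k\<close> of them turn a tensor of degree
  \<open>k\<close> into a number, read at \<open>[]\<close>.\<close>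

definition contract :: "complex^'m \<Rightarrow> 'm tensor \<Rightarrow> 'm tensor" where
  "contract v T = (\<lambda>w. \<Sum>i\<in>UNIV. v $ i * T (i # w))"

text \<open>Symmetry without a fixed degree, since contraction lowers the degree.\<close>

definition symmetric :: "'i tensor \<Rightarrow> bool" where
  "symmetric T \<longleftrightarrow> (\<forall>w w'. mset w = mset w' \<longrightarrow> T w = T w')"

lemma sym_tensors_iff: "T \<in> sym_tensors k \<longleftrightarrow> T \<in> tensor_power k \<and> symmetric T"
  by (simp add: sym_tensors_def symmetric_def)

lemma symmetric_contract: "symmetric T \<Longrightarrow> symmetric (contract v T)"
  unfolding symmetric_def contract_def by (metis (no_types, lifting) mset.simps(2) sum.cong)

lemma symmetric_funpow_contract: "symmetric T \<Longrightarrow> symmetric ((contract v ^^ n) T)"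
  by (induction n) (auto simp: symmetric_contract)

lemma contract_commute:
  assumes "symmetric T"
  shows "contract x (contract y T) = contract y (contract x T)"
proof
  fix w
  have swap: "T (j # i # w) = T (i # j # w)" for i j
    using assms by (simp add: symmetric_def add_mset_commute)
  have "contract x (contract y T) w = (\<Sum>i\<in>UNIV. \<Sum>j\<in>UNIV. x $ i * (y $ j * T (i # j # w)))"
    by (simp add: contract_def sum_distrib_left swap)
  also have "\<dots> = (\<Sum>j\<in>UNIV. \<Sum>i\<in>UNIV. x $ i * (y $ j * T (i # j # w)))"
    by (rule sum.swap)
  also have "\<dots> = contract y (contract x T) w"
    by (simp add: contract_def sum_distrib_left mult.left_commute)
  finally show "contract x (contract y T) w = contract y (contract x T) w" .
qed

lemma contract_funpow_commute:
  assumes "symmetric T"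
  shows "contract x ((contract y ^^ n) T) = (contract y ^^ n) (contract x T)"
proof (induction n)
  case (Suc n)
  show ?case
    using contract_commute[OF symmetric_funpow_contract[OF assms, of n y], of x y] Suc by simp
qed simp

lemma contract_zero_tensor [simp]: "contract v (\<lambda>_. 0) = (\<lambda>_. 0)"
  by (simp add: contract_def)

lemma contract_zero [simp]: "contract 0 T = (\<lambda>_. 0)"
  by (simp add: contract_def)

lemma funpow_contract_zero_tensor [simp]: "(contract v ^^ n) (\<lambda>_. 0) = (\<lambda>_. 0)"
  by (induction n) auto

lemma contract_add_vector: "contract (x + y) T w = contract x T w + contract y T w"
  by (simp add: contract_def distrib_right sum.distrib)

lemma contract_scale_vector: "contract (c *s x) T w = c * contract x T w"
  by (simp add: contract_def sum_distrib_left mult.assoc)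

lemma contract_linear_tensor:
  "contract v (\<lambda>w. S w + c * T w) = (\<lambda>w. contract v S w + c * contract v T w)"
  by (simp add: contract_def distrib_left sum.distrib sum_distrib_left mult.left_commute)

lemma contract_funpow_linear_tensor:
  "(contract v ^^ n) (\<lambda>w. S w + c * T w) = (\<lambda>w. (contract v ^^ n) S w + c * (contract v ^^ n) T w)"
  by (induction n) (simp_all add: contract_linear_tensor)

lemma contract_axis: "contract (axis i 1) T w = T (i # w)"
  by (simp add: contract_def axis_def if_distrib[of "\<lambda>z. z * _"] cong: if_cong)

lemma words_Suc: "{w :: 'i list. length w = Suc n} = (\<lambda>(i, w). i # w) ` (UNIV \<times> {w. length w = n})"
  by (auto simp: length_Suc_conv image_iff)

lemma finite_words: "finite {w :: 'i::finite list. length w = n}"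
  using finite_lists_length_eq[of "UNIV :: 'i set" n] by simp

lemma sum_words_Suc:
  "(\<Sum>w | length w = Suc n. g w) = (\<Sum>i\<in>UNIV. \<Sum>w | length w = n. g (i # w))"
  for g :: "'i::finite list \<Rightarrow> complex"
proof -
  have "inj_on (\<lambda>(i, w). i # w) (UNIV \<times> {w :: 'i list. length w = n})"
    by (auto simp: inj_on_def)
  then show ?thesis
    by (simp add: words_Suc sum.reindex sum.cartesian_product case_prod_unfold)
qed

lemma contract_funpow:
  "(contract v ^^ n) T u = (\<Sum>w | length w = n. T (w @ u) * (\<Prod>i\<leftarrow>w. v $ i))"
proof (induction n arbitrary: T u)
  case (Suc n)
  have "(contract v ^^ Suc n) T u = (contract v ^^ n) (contract v T) u"
    by (simp add: funpow_swap1)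
  also have "\<dots> = (\<Sum>w | length w = n. \<Sum>i\<in>UNIV. T (i # w @ u) * (v $ i * (\<Prod>i\<leftarrow>w. v $ i)))"
    by (simp add: Suc.IH contract_def sum_distrib_left ac_simps)
  also have "\<dots> = (\<Sum>w | length w = Suc n. T (w @ u) * (\<Prod>i\<leftarrow>w. v $ i))"
    unfolding sum_words_Suc by (subst sum.swap) simp
  finally show ?case .
qed simp

section \<open>Words, monomials and polarization\<close>

definition word_monomial :: "'i list \<Rightarrow> 'i \<Rightarrow>\<^sub>0 nat" where
  "word_monomial w = (\<Sum>i\<leftarrow>w. Poly_Mapping.single i 1)"

lemma mono_eval_word: "mono_eval (word_monomial w) x = (\<Prod>i\<leftarrow>w. x i)"
  unfolding word_monomial_def by (induction w) (simp_all add: mono_eval_add del: One_nat_def)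

lemma lookup_word_monomial: "lookup (word_monomial w) i = count (mset w) i"
  unfolding word_monomial_def by (induction w) (simp_all add: lookup_add lookup_single when_def)

lemma degree_word_monomial: "monomial_degree (word_monomial (w :: 'i::finite list)) = length w"
proof (induction w)
  case (Cons i w)
  have "monomial_degree (Poly_Mapping.single i (1::nat)) = 1"
    by (simp add: monomial_degree_def)
  then show ?case using Cons by (simp add: word_monomial_def monomial_degree_add)
qed (simp add: word_monomial_def monomial_degree_eq_0)

lemma ex_word:
  fixes m :: "'i::finite \<Rightarrow>\<^sub>0 nat"
  shows "\<exists>w. word_monomial w = m"
proof -
  obtain w where "mset w = Abs_multiset (lookup m)" using ex_mset by blast
  then have "lookup (word_monomial w) i = lookup m i" for i
    by (simp add: lookup_word_monomial count_Abs_multiset)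
  then show ?thesis by (blast intro: poly_mapping_eqI)
qed

lemma tensor_power_support:
  fixes T :: "'i::finite tensor"
  assumes "T \<in> tensor_power k"
  shows "{w. T w \<noteq> 0} \<subseteq> {w. length w = k}"
  using assms by (auto simp: tensor_power_def)

lemma poly_eval_tensor_poly:
  assumes "T \<in> tensor_power k"
  shows "poly_eval (tensor_poly T) (($) v) = (contract v ^^ k) T []"
proof -
  have "tensor_poly T = (\<Sum>w | T w \<noteq> 0. Poly_Mapping.single (word_monomial w) (T w))"
    by (simp only: tensor_poly_def word_monomial_def)
  then have "poly_eval (tensor_poly T) (($) v) = (\<Sum>w | T w \<noteq> 0. T w * (\<Prod>i\<leftarrow>w. v $ i))"
    by (simp add: mono_eval_word)
  also have "\<dots> = (\<Sum>w | length w = k. T w * (\<Prod>i\<leftarrow>w. v $ i))"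
    using tensor_power_support[OF assms] finite_words by (intro sum.mono_neutral_left) auto
  also have "\<dots> = (contract v ^^ k) T []"
    by (simp add: contract_funpow)
  finally show ?thesis .
qed

lemma tensor_poly_homogeneous:
  fixes T :: "'i::finite tensor"
  assumes "T \<in> tensor_power k"
  shows "tensor_poly T \<in> homogeneous k"
  unfolding homogeneous_def
proof safe
  fix m assume m: "m \<in> keys (tensor_poly T)"
  have fin: "finite {w. T w \<noteq> 0}"
    using tensor_power_support[OF assms] finite_words by (rule finite_subset)
  have "keys (tensor_poly T) \<subseteq> (\<Union>w\<in>{w. T w \<noteq> 0}. keys (Poly_Mapping.single (word_monomial w) (T w)))"
    unfolding tensor_poly_def word_monomial_def by (rule keys_sum) 
  then obtain w where "T w \<noteq> 0" "m = word_monomial w" using m by (auto split: if_splits)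
  then show "monomial_degree m = k"
    using tensor_power_support[OF assms] by (auto simp: degree_word_monomial)
qed

lemma contract_tensor_power:
  "T \<in> tensor_power (Suc k) \<Longrightarrow> contract v T \<in> tensor_power k"
  by (auto simp: tensor_power_def contract_def)

text \<open>In finitely many variables this inverts \<open>tensor_poly\<close> in degree
  \<open>d\<close>: each coefficient is shared equally among the words with that monomial, whose
  number is a multinomial coefficient.\<close>

definition polarization :: "nat \<Rightarrow> 'i cpoly \<Rightarrow> 'i tensor" where
  "polarization d p = (\<lambda>w. if length w = d
     then lookup p (word_monomial w) / of_nat (card {w'. word_monomial w' = word_monomial w}) else 0)"

lemma word_monomial_cong: "mset w = mset w' \<Longrightarrow> word_monomial w = word_monomial w'"
  by (rule poly_mapping_eqI) (simp add: lookup_word_monomial)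

lemma polarization_sym: "polarization d p \<in> sym_tensors d"
  unfolding sym_tensors_def
proof (intro CollectI conjI allI impI)
  show "polarization d p \<in> tensor_power d" by (simp add: tensor_power_def polarization_def)
  fix w w' :: "'a list" assume "mset w = mset w'"
  then have "length w = length w'" "word_monomial w = word_monomial w'"
    by (rule mset_eq_length, rule word_monomial_cong)
  then show "polarization d p w = polarization d p w'" by (simp add: polarization_def)
qed

lemma finite_words_of_monomial: "finite {w :: 'i::finite list. word_monomial w = m}"
  by (rule finite_subset[OF _ finite_words[of "monomial_degree m"]])
    (auto simp flip: degree_word_monomial)

lemma card_words_of_monomial: "card {w :: 'i::finite list. word_monomial w = m} \<noteq> 0"
  using ex_word[of m] finite_words_of_monomial[of m] by auto

lemma contract_polarization:
  assumes p: "p \<in> homogeneous d"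
  shows "(contract v ^^ d) (polarization d p) [] = poly_eval p (($) v)"
proof -
  define S where "S = {w. length w = d \<and> word_monomial w \<in> keys p}"
  have fin: "finite S" by (rule finite_subset[OF _ finite_words[of d]]) (auto simp: S_def)
  have "(contract v ^^ d) (polarization d p) []
      = (\<Sum>w | length w = d. polarization d p w * mono_eval (word_monomial w) (($) v))"
    by (simp add: contract_funpow mono_eval_word)
  also have "\<dots> = (\<Sum>w\<in>S. polarization d p w * mono_eval (word_monomial w) (($) v))"
    by (rule sum.mono_neutral_right[OF finite_words])
      (auto simp: S_def polarization_def in_keys_iff)
  also have "\<dots> = (\<Sum>m\<in>keys p. \<Sum>w | w \<in> S \<and> word_monomial w = m.
      polarization d p w * mono_eval (word_monomial w) (($) v))"
    by (rule sum.group[symmetric]) (auto simp: fin, auto simp: S_def)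
  also have "\<dots> = (\<Sum>m\<in>keys p. lookup p m * mono_eval m (($) v))"
  proof (rule sum.cong)
    fix m assume m: "m \<in> keys p"
    \<comment> \<open>By homogeneity every word with monomial \<open>m\<close> has length
      \<open>d\<close>, so all of them are in \<open>S\<close> and their number cancels the
      denominator.\<close>
    then have *: "{w. w \<in> S \<and> word_monomial w = m} = {w. word_monomial w = m}"
      using p by (auto simp: S_def homogeneous_def degree_word_monomial[symmetric])
    have "polarization d p w = lookup p m / of_nat (card {w :: 'a list. word_monomial w = m})"
      if "word_monomial w = m" for w
      using that p m by (auto simp: polarization_def homogeneous_def degree_word_monomial[symmetric])
    then show "(\<Sum>w | w \<in> S \<and> word_monomial w = m.
        polarization d p w * mono_eval (word_monomial w) (($) v)) = lookup p m * mono_eval m (($) v)"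
      using card_words_of_monomial[of m] unfolding * by simp
  qed simp
  finally show ?thesis by (simp add: poly_eval_keys)
qed

lemma polarization_nonzero:
  fixes p :: "'i::finite cpoly"
  assumes p: "p \<in> homogeneous d" "p \<noteq> 0"
  shows "polarization d p \<noteq> (\<lambda>_. 0)"
proof -
  obtain m where m: "m \<in> keys p" using p(2) by (metis all_not_in_conv keys_eq_empty)
  obtain w where w: "word_monomial w = m" using ex_word by blast
  have "polarization d p w \<noteq> 0"
    using p(1) m w card_words_of_monomial[of m]
    by (auto simp: polarization_def homogeneous_def degree_word_monomial[symmetric] in_keys_iff)
  then show ?thesis by auto
qed

section \<open>Symmetric tensors and secants\<close>

text \<open>A binomial expansion of commuting contractions, cut off after the linear term because
  contracting twice with \<open>x\<close> gives zero.\<close>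

lemma contract_funpow_add:
  assumes T: "symmetric T" and x: "contract x (contract x T) = (\<lambda>_. 0)"
  shows "(contract (x + y) ^^ Suc n) T
    = (\<lambda>w. (contract y ^^ Suc n) T w + of_nat (Suc n) * contract x ((contract y ^^ n) T) w)"
proof (induction n)
  case 0
  show ?case by (simp add: fun_eq_iff contract_add_vector)
next
  case (Suc n)
  have xx: "contract x (contract x ((contract y ^^ n) T)) = (\<lambda>_. 0)"
    by (simp add: contract_funpow_commute T symmetric_contract x)
  have yx: "contract y (contract x ((contract y ^^ n) T)) = contract x ((contract y ^^ Suc n) T)"
    by (simp add: contract_commute[of _ y x] T symmetric_funpow_contract)
  have "(contract (x + y) ^^ Suc (Suc n)) T w
      = contract (x + y) (\<lambda>w. (contract y ^^ Suc n) T w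
          + of_nat (Suc n) * contract x ((contract y ^^ n) T) w) w" for w
    unfolding Suc.IH[symmetric] by simp
  also have "\<dots> w = (contract y ^^ Suc (Suc n)) T w
      + of_nat (Suc (Suc n)) * contract x ((contract y ^^ Suc n) T) w" for w
    unfolding contract_linear_tensor contract_add_vector xx yx by (simp add: algebra_simps)
  finally show ?case by (rule ext)
qed

text \<open>A pigeonhole argument: in \<open>T(y, \<dots>, y)\<close> with \<open>y\<close> a sum of \<open>r\<close> vectors, every term of the
  multilinear expansion repeats one of them.\<close>

lemma contract_funpow_span_eq_0:
  assumes T: "symmetric T"
    and ls: "\<And>l x. l \<in> set ls \<Longrightarrow> x \<in> l \<Longrightarrow> contract x (contract x T) = (\<lambda>_. 0)"
      "\<And>l. l \<in> set ls \<Longrightarrow> vec.subspace l"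
    and y: "y \<in> vec.span (\<Union>(set ls))"
  shows "(contract y ^^ Suc (length ls)) T = (\<lambda>_. 0)"
  using ls y
proof (induction ls arbitrary: y)
  case Nil
  then show ?case by simp
next
  case (Cons l ls)
  obtain a b where ab: "y = a + b" "a \<in> vec.span l" "b \<in> vec.span (\<Union>(set ls))"
    using Cons.prems(3) by (auto simp: vec.span_Un)
  \<comment> \<open>Each \<open>l\<close> is a subspace, so the component \<open>a\<close> lies in
    \<open>l\<close> itself and the double contraction hypothesis applies to it.\<close>
  have "vec.span l \<subseteq> l" using Cons.prems(2) by (intro vec.span_minimal) auto
  then have "a \<in> l" using ab(2) by blast
  then have a: "contract a (contract a T) = (\<lambda>_. 0)" by (intro Cons.prems(1)[of l]) auto
  have b: "(contract b ^^ Suc (length ls)) T = (\<lambda>_. 0)"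
    using Cons.prems ab(3) by (intro Cons.IH) auto
  \<comment> \<open>The expansion for \<open>a + b\<close> involves this power of \<open>b\<close>
    and the preceding one.\<close>
  have bb: "(contract b ^^ Suc (Suc (length ls))) T = (\<lambda>_. 0)"
    using b by (metis contract_zero_tensor funpow.simps(2) o_apply)
  show ?case
    unfolding ab(1) length_Cons contract_funpow_add[OF T a] b bb by simp
qed

text \<open>The product rule for \<open>n\<close> equal arguments; symmetry moves the differentiated
  slot to the front, so all \<open>n\<close> terms coincide.\<close>

lemma contract_funpow_has_derivative:
  assumes T: "symmetric T"
  shows "((\<lambda>t. (contract (y + t *s x) ^^ n) T w) has_field_derivative
    of_nat n * (contract y ^^ (n - 1)) (contract x T) w) (at 0)"
  using T
proof (induction n arbitrary: T)
  case 0
  then show ?case by simp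
next
  case (Suc n)
  have step: "(contract (y + t *s x) ^^ Suc n) T w
      = (contract (y + t *s x) ^^ n) (contract y T) w + t * (contract (y + t *s x) ^^ n) (contract x T) w"
    for t
  proof -
    have "contract (y + t *s x) T = (\<lambda>w. contract y T w + t * contract x T w)"
      by (simp add: fun_eq_iff contract_add_vector contract_scale_vector)
    then show ?thesis
      by (simp add: funpow_Suc_right contract_funpow_linear_tensor del: funpow.simps)
  qed
  \<comment> \<open>For \<open>n = 0\<close> the truncated \<open>n - 1\<close> is harmless, as it
    comes with the factor 0.\<close>
  have d: "of_nat n * (contract y ^^ (n - 1)) (contract x (contract y T)) w
        + (1 * (contract (y + 0 *s x) ^^ n) (contract x T) w
          + of_nat n * (contract y ^^ (n - 1)) (contract x (contract x T)) w * 0)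
      = of_nat (Suc n) * (contract y ^^ (Suc n - 1)) (contract x T) w"
  proof (cases n)
    case (Suc k)
    have "(contract y ^^ k) (contract x (contract y T)) = (contract y ^^ Suc k) (contract x T)"
      by (simp add: contract_commute[OF Suc.prems, of x y] funpow_Suc_right del: funpow.simps)
    then show ?thesis using Suc by (simp add: algebra_simps)
  qed simp
  show ?case
    unfolding step
    by (rule DERIV_cong[OF _ d])
      (intro DERIV_add DERIV_mult DERIV_ident Suc.IH symmetric_contract Suc.prems)
qed

text \<open>Differentiating \<open>T(y + t x, \<dots>, y + t x)\<close> at \<open>t = 0\<close> passes from \<open>T\<close> to its contraction
  with \<open>x\<close>, which has one degree less.\<close>

lemma sym_tensor_eq_0:
  assumes "T \<in> sym_tensors d" and B: "vec.span B = UNIV"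
    and "\<And>xs y. length xs = d \<Longrightarrow> set xs \<subseteq> B \<Longrightarrow> y \<in> vec.span (set xs) \<Longrightarrow> (contract y ^^ d) T [] = 0"
  shows "T = (\<lambda>_. 0)"
  using assms(1,3)
proof (induction d arbitrary: T)
  case 0
  have "T [] = 0" using "0.prems"(2)[of "[]" 0] by simp
  moreover have "T w = 0" if "w \<noteq> []" for w
    using "0.prems"(1) that by (simp add: sym_tensors_iff tensor_power_def)
  ultimately show ?case by (intro ext) metis
next
  case (Suc d)
  have T: "T \<in> tensor_power (Suc d)" "symmetric T" using Suc.prems(1) by (auto simp: sym_tensors_iff)
  have "contract x T = (\<lambda>_. 0)" if x: "x \<in> B" for x
  proof (rule Suc.IH)
    show "contract x T \<in> sym_tensors d"
      using T by (simp add: sym_tensors_iff contract_tensor_power symmetric_contract)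
    fix xs y assume xs: "length xs = d" "set xs \<subseteq> B" "y \<in> vec.span (set xs)"
    \<comment> \<open>The extra list entry \<open>x\<close> admits the whole line through
      \<open>y\<close> in direction \<open>x\<close>, so the function differentiated below is
      identically zero.\<close>
    have "(contract (y + t *s x) ^^ Suc d) T [] = 0" for t
    proof (rule Suc.prems(2))
      show "length (x # xs) = Suc d" "set (x # xs) \<subseteq> B" using xs x by auto
      have "x \<in> vec.span (set (x # xs))" by (rule vec.span_base) simp
      moreover have "y \<in> vec.span (set (x # xs))" using xs(3) vec.span_mono[of "set xs" "set (x # xs)"] by auto
      ultimately show "y + t *s x \<in> vec.span (set (x # xs))"
        by (intro vec.span_add vec.span_scale)
    qed
    then have "((\<lambda>t::complex. 0) has_field_derivative of_nat (Suc d) * (contract y ^^ d) (contract x T) []) (at 0)"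
      using contract_funpow_has_derivative[OF T(2), where y = y and x = x and n = "Suc d" and w = "[]"] by simp
    then have "of_nat (Suc d) * (contract y ^^ d) (contract x T) [] = 0"
      by (rule DERIV_unique) simp
    then show "(contract y ^^ d) (contract x T) [] = 0" by (simp del: of_nat_Suc)
  qed
  \<comment> \<open>The vectors killing \<open>T\<close> form a subspace containing
    \<open>B\<close>, hence are all vectors; coordinate vectors then recover the entries of
    \<open>T\<close> at nonempty words.\<close>
  moreover have "vec.subspace {x. contract x T = (\<lambda>_. 0)}"
    by (rule vec.subspaceI) (auto simp: fun_eq_iff contract_add_vector contract_scale_vector)
  ultimately have "vec.span B \<subseteq> {x. contract x T = (\<lambda>_. 0)}"
    by (intro vec.span_minimal) auto
  then have "contract x T = (\<lambda>_. 0)" for x using B by auto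
  then have "T (i # w) = 0" for i w by (metis contract_axis)
  moreover have "T [] = 0" using T by (simp add: tensor_power_def)
  ultimately show ?case by (metis ext neq_Nil_conv)
qed

section \<open>Secant varieties and prolongations\<close>

lemma topspace_zariski_proj: "topspace (zariski_proj :: (complex^'m) set topology) = proj UNIV"
proof -
  have "(1 :: 'm cpoly) \<in> homogeneous 0"
    by (simp add: homogeneous_def monomial_degree_eq_0 flip: single_one)
  moreover have "poly_eval (1 :: 'm cpoly) x = 1" for x by (simp flip: single_one)
  ultimately have "proj UNIV \<in> {{l \<in> proj UNIV. \<forall>v\<in>l - {0}. poly_eval p (($) v) \<noteq> 0}
      | p :: 'm cpoly. \<exists>d. p \<in> homogeneous d}"
    by (intro CollectI exI[of _ 1]) auto
  then show ?thesis
    unfolding zariski_proj_def topology_generated_by_topspace by blast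
qed

lemma proj_mono: "W \<subseteq> W' \<Longrightarrow> proj W \<subseteq> proj W'"
  by (auto simp: proj_def)

lemma proj_span_subset_secant:
  assumes "length ls = r" "set ls \<subseteq> X"
  shows "proj (vec.span (\<Union>(set ls))) \<subseteq> secant X r"
proof -
  let ?U = "\<Union>xs\<in>{xs. length xs = r \<and> set xs \<subseteq> X}. proj (vec.span (\<Union>(set xs)))"
  have "?U \<subseteq> topspace zariski_proj"
    unfolding topspace_zariski_proj by (auto dest: subsetD[OF proj_mono[OF subset_UNIV]])
  then have "?U \<subseteq> secant X r" unfolding secant_def by (rule closure_of_subset)
  then show ?thesis using assms by blast
qed

text \<open>Makes \<open>r = 0\<close> a candidate in (i), so that the set of candidates is never
  empty.\<close>

lemma secant_0: "secant X 0 = {}"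
  by (simp add: secant_def proj_def)

text \<open>The nonvanishing set of a homogeneous polynomial is open; if it contained a point of the
  closure, it would meet the union of spans, where \<open>p\<close> is zero.\<close>

lemma vanishes_on_secant:
  fixes X :: "(complex^'m) set set"
  assumes p: "p \<in> homogeneous d"
    and van: "\<And>ls y. length ls = r \<Longrightarrow> set ls \<subseteq> X \<Longrightarrow> y \<in> vec.span (\<Union>(set ls)) \<Longrightarrow> poly_eval p (($) y) = 0"
    and l: "l \<in> secant X r" "v \<in> l" "v \<noteq> 0"
  shows "poly_eval p (($) v) = 0"
proof (rule ccontr)
  assume nz: "poly_eval p (($) v) \<noteq> 0"
  let ?U = "\<Union>xs\<in>{xs. length xs = r \<and> set xs \<subseteq> X}. proj (vec.span (\<Union>(set xs)))"
  define Q where "Q = {l \<in> proj UNIV. \<forall>v\<in>l - {0}. poly_eval p (($) v) \<noteq> 0}"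
  have op: "openin zariski_proj Q"
    unfolding zariski_proj_def by (rule topology_generated_by_Basis) (use p in \<open>auto simp: Q_def\<close>)
  have l': "l \<in> zariski_proj closure_of ?U" using l(1) by (simp add: secant_def)
  then have "l \<in> proj UNIV" by (auto simp: in_closure_of topspace_zariski_proj)
  \<comment> \<open>Homogeneity carries nonvanishing from \<open>v\<close> to all nonzero vectors of
    its line, as membership in \<open>Q\<close> demands.\<close>
  have "poly_eval p (($) u) \<noteq> 0" if u: "u \<in> l" "u \<noteq> 0" for u
  proof -
    obtain z where "l = vec.span {z}" using \<open>l \<in> proj UNIV\<close> by (auto simp: proj_def)
    then obtain a b where ab: "u = a *s z" "v = b *s z" using u(1) l(2) by (auto simp: vec.span_singleton)
    then have "a \<noteq> 0" using u(2) by auto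
    then have "v = (b / a) *s u" using ab by simp
    then have "poly_eval p (($) v) = (b / a) ^ d * poly_eval p (($) u)"
      using poly_eval_homogeneous_scale[OF p, of "b / a" "($) u"]
      by (simp add: vector_scalar_mult_def vec_lambda_inverse)
    then show ?thesis using nz by auto
  qed
  then have "l \<in> Q" using \<open>l \<in> proj UNIV\<close> by (simp add: Q_def)
  then obtain k where k: "k \<in> ?U" "k \<in> Q" using l' op unfolding in_closure_of by blast
  then obtain xs z where xs: "length xs = r" "set xs \<subseteq> X" "k = vec.span {z}"
      "z \<in> vec.span (\<Union>(set xs))" "z \<noteq> 0"
    by (auto simp: proj_def)
  then have "poly_eval p (($) z) \<noteq> 0" using k(2) vec.span_base[of z "{z}"] by (auto simp: Q_def)
  then show False using van xs by blast
qed

section \<open>Prolongations and their vanishing on spans\<close>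

lemma tensor_mult_Cons_Cons:
  assumes "a \<in> tensor_power 2"
  shows "tensor_mult a b (j # i # w) = a [j, i] * b w"
proof -
  \<comment> \<open>Of all cuts of the word only the one after two letters counts, since
    \<open>a\<close> lives on words of length 2.\<close>
  have "tensor_mult a b (j # i # w)
      = (\<Sum>k\<le>length (j # i # w). if k = 2 then a [j, i] * b w else 0)"
    unfolding tensor_mult_def
  proof (rule sum.cong)
    fix k assume k: "k \<in> {..length (j # i # w)}"
    show "a (take k (j # i # w)) * b (drop k (j # i # w)) = (if k = 2 then a [j, i] * b w else 0)"
    proof (cases "k = 2")
      case False
      then have "length (take k (j # i # w)) \<noteq> 2" using k by auto
      then have "a (take k (j # i # w)) = 0" using assms unfolding tensor_power_def by blast
      then show ?thesis using False by simp
    qed (simp add: numeral_2_eq_2)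
  qed simp
  also have "\<dots> = a [j, i] * b w" by (subst sum.delta) auto
  finally show ?thesis .
qed

text \<open>The first two slots of each summand belong to a quadric through \<open>X\<close>;
  contracting both with \<open>x\<close> produces its value at \<open>x\<close> as a factor.\<close>

lemma contract_contract_prolongation:
  assumes T: "T \<in> prolongation k (quadric_tensors X)" and x: "l \<in> X" "x \<in> l"
  shows "contract x (contract x T) = (\<lambda>_. 0)"
proof
  fix w
  obtain N a b where ab: "T = (\<lambda>w. \<Sum>n<(N::nat). tensor_mult (a n) (b n) w)"
      "\<And>n. n < N \<Longrightarrow> a n \<in> quadric_tensors X"
    using T unfolding prolongation_def tensor_space_def by blast
  have a: "a n \<in> tensor_power 2" "contract x (contract x (a n)) [] = 0" if "n < N" for n
  proof -
    show a2: "a n \<in> tensor_power 2" using ab(2)[OF that] by (simp add: quadric_tensors_def sym_tensors_def)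
    have "tensor_poly (a n) \<in> vanishing_ideal X" using ab(2)[OF that] by (simp add: quadric_tensors_def)
    then have "poly_eval (tensor_poly (a n)) (($) x) = 0" using x by (auto simp: vanishing_ideal_def)
    then show "contract x (contract x (a n)) [] = 0"
      by (simp add: poly_eval_tensor_poly[OF a2] numeral_2_eq_2)
  qed
  have "contract x (contract x T) w
      = (\<Sum>i\<in>UNIV. \<Sum>j\<in>UNIV. \<Sum>n<N. x $ i * (x $ j * (a n [j, i] * b n w)))"
    by (simp add: contract_def ab(1) sum_distrib_left tensor_mult_Cons_Cons a(1))
  also have "\<dots> = (\<Sum>n<N. \<Sum>i\<in>UNIV. \<Sum>j\<in>UNIV. x $ i * (x $ j * (a n [j, i] * b n w)))"
    by (subst sum.swap, subst sum.swap, rule sum.cong) (auto intro: sum.swap)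
  also have "\<dots> = (\<Sum>n<N. contract x (contract x (a n)) [] * b n w)"
    by (simp add: contract_def sum_distrib_left sum_distrib_right mult.assoc)
  also have "\<dots> = 0" using a(2) by simp
  finally show "contract x (contract x T) w = 0" .
qed

text \<open>The degree \<open>k + 2\<close> exceeds the number \<open>k + 1\<close> of lines by one,
  which is the margin the pigeonhole argument needs.\<close>

lemma prolongation_vanishes_on_spans:
  assumes T: "T \<in> prolongation k (quadric_tensors X)" and X: "X \<subseteq> proj UNIV"
    and ls: "length ls = Suc k" "set ls \<subseteq> X" and y: "y \<in> vec.span (\<Union>(set ls))"
  shows "poly_eval (tensor_poly T) (($) y) = 0"
proof -
  have T': "T \<in> tensor_power (k + 2)" "symmetric T"
    using T by (auto simp: prolongation_def sym_tensors_iff)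
  have "(contract y ^^ Suc (length ls)) T = (\<lambda>_. 0)"
  proof (rule contract_funpow_span_eq_0[OF T'(2) _ _ y])
    show "vec.subspace l" if "l \<in> set ls" for l
      using that ls(2) X by (auto simp: proj_def)
  qed (use contract_contract_prolongation[OF T] ls(2) in blast)
  then show ?thesis using ls(1) by (simp add: poly_eval_tensor_poly[OF T'(1)] del: funpow.simps)
qed

section \<open>The closed orbit and the two assertions\<close>

lemma closed_orbit_nonempty: "closed_orbit G \<rho> X \<Longrightarrow> connected_semisimple G \<Longrightarrow> X \<noteq> {}"
  by (auto simp: closed_orbit_def orbit_def connected_semisimple_def linear_algebraic_group_def
      dest: subgroup.one_closed)

lemma closed_orbit_subset_proj:
  fixes \<rho> :: "complex^'n^'n \<Rightarrow> complex^'m^'m"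
  assumes "closed_orbit G \<rho> X"
  shows "X \<subseteq> proj UNIV"
  using assms closedin_subset topspace_zariski_proj unfolding closed_orbit_def by blast

lemma closed_orbit_span:
  fixes \<rho> :: "complex^'n^'n \<Rightarrow> complex^'m^'m"
  assumes G: "connected_semisimple G" and irr: "irreducible_module G \<rho>" and orb: "closed_orbit G \<rho> X"
  shows "vec.span (\<Union>X) = UNIV"
proof -
  obtain l where l: "X = orbit G \<rho> l" using orb by (auto simp: closed_orbit_def)
  have mult: "g ** h \<in> G" if "g \<in> G" "h \<in> G" for g h
    using G that subgroup.m_closed[of G GL g h]
    by (simp add: connected_semisimple_def linear_algebraic_group_def GL_def)
  have hom: "\<rho> (g ** h) = \<rho> g ** \<rho> h" if "g \<in> G" "h \<in> G" for g h
    using irr that by (auto simp: irreducible_module_def rational_module_def hom_def GL_def)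
  have inv: "\<rho> g *v w \<in> vec.span (\<Union>X)" if g: "g \<in> G" and w: "w \<in> vec.span (\<Union>X)" for g w
  proof -
    have "\<Union>X \<subseteq> {w. \<rho> g *v w \<in> vec.span (\<Union>X)}"
    proof safe
      fix w k assume "w \<in> k" "k \<in> X"
      then obtain h u where hu: "h \<in> G" "u \<in> l" "w = \<rho> h *v u" by (auto simp: l orbit_def)
      then have "\<rho> g *v w = \<rho> (g ** h) *v u" by (simp add: hom g matrix_vector_mul_assoc)
      then have "\<rho> g *v w \<in> \<Union>X" using mult[OF g hu(1)] hu(2) by (auto simp: l orbit_def)
      then show "\<rho> g *v w \<in> vec.span (\<Union>X)" by (rule vec.span_base)
    qed
    moreover have "vec.subspace {w. \<rho> g *v w \<in> vec.span (\<Union>X)}"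
      by (rule vec.subspaceI)
        (auto simp: vec.add vec.scale vec.span_zero intro: vec.span_add vec.span_scale)
    ultimately show ?thesis using vec.span_minimal w by blast
  qed
  obtain k where "k \<in> X" using closed_orbit_nonempty[OF orb G] by blast
  moreover then obtain z where "k = vec.span {z}" "z \<noteq> 0"
    using closed_orbit_subset_proj[OF orb] by (auto simp: proj_def)
  ultimately have "z \<in> vec.span (\<Union>X)" "z \<noteq> 0" by (auto intro!: vec.span_base)
  then have "vec.span (\<Union>X) \<noteq> {0}" by blast
  then show ?thesis
    using irr inv vec.subspace_span unfolding irreducible_module_def by blast
qed

lemma secant_not_unstable:
  fixes \<rho> :: "complex^'n^'n \<Rightarrow> complex^'m^'m"
  assumes X: "vec.span (\<Union>X) = UNIV" "X \<noteq> {}"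
    and f: "f \<in> invariants G \<rho>" "f \<in> homogeneous d" "f \<noteq> 0" "d > 0"
    and r: "secant X r \<subseteq> unstable_locus G \<rho>"
  shows "r < d"
proof (rule ccontr)
  assume "\<not> r < d"
  note f1 = homogeneous_in_invariants_ge1[OF f(1,2,4)]
  obtain l\<^sub>0 where l\<^sub>0: "l\<^sub>0 \<in> X" using X(2) by blast
  have "polarization d f = (\<lambda>_. 0)"
  proof (rule sym_tensor_eq_0[OF polarization_sym X(1)])
    fix xs y assume xs: "length xs = d" "set xs \<subseteq> \<Union>X" "y \<in> vec.span (set xs)"
    have "poly_eval f (($) y) = 0"
    \<comment> \<open>The zero vector spans no point of projective space; there the value of
      \<open>f\<close> at the origin decides.\<close>
    proof (cases "y = 0")
      case True
      then have "($) y = (\<lambda>_. 0)" by auto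
      then show ?thesis using f1 by (simp add: invariants_ge1_def)
    next
      case False
      have "\<forall>x\<in>set xs. \<exists>l. l \<in> X \<and> x \<in> l" using xs(2) by blast
      from bchoice[OF this] obtain L where L: "\<forall>x\<in>set xs. L x \<in> X \<and> x \<in> L x" by blast
      \<comment> \<open>The \<open>d\<close> lines are padded to exactly \<open>r\<close> by
        repeating one; enlarging the span does no harm. This stands in for the nesting of secant
        varieties.\<close>
      define ls where "ls = map L xs @ replicate (r - d) l\<^sub>0"
      have ls: "length ls = r" "set ls \<subseteq> X" "set xs \<subseteq> \<Union>(set ls)"
        using xs(1) L l\<^sub>0 \<open>\<not> r < d\<close> by (auto simp: ls_def)
      have "y \<in> vec.span (\<Union>(set ls))" using xs(3) vec.span_mono[OF ls(3)] by blast
      then have "vec.span {y} \<in> proj (vec.span (\<Union>(set ls)))" using False by (auto simp: proj_def)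
      then have "vec.span {y} \<in> unstable_locus G \<rho>" using proj_span_subset_secant[OF ls(1,2)] r by blast
      then show ?thesis
        using f1 vec.span_base[of y "{y}"] by (auto simp: unstable_locus_def zero_locus_def)
    qed
    then show "(contract y ^^ d) (polarization d f) [] = 0"
      by (simp add: contract_polarization[OF f(2)])
  qed
  then show False using polarization_nonzero[OF f(2,3)] by simp
qed

text \<open>A nonzero common zero of the invariants spans a point of the unstable locus, hence of
  the secant variety; the origin is covered because the degree is positive.\<close>

lemma prolongation_in_radical:
  fixes \<rho> :: "complex^'n^'n \<Rightarrow> complex^'m^'m"
  assumes X: "X \<subseteq> proj UNIV" and us: "unstable_locus G \<rho> \<subseteq> secant X (Suc k)"
    and T: "T \<in> prolongation k (quadric_tensors X)"
  shows "tensor_poly T \<in> ideal_radical (is_ideal hull invariants_ge1 G \<rho>)"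
proof (rule nullstellensatz)
  have hom: "tensor_poly T \<in> homogeneous (k + 2)"
    using T by (intro tensor_poly_homogeneous) (simp add: prolongation_def sym_tensors_iff)
  fix x assume x: "\<forall>p\<in>invariants_ge1 G \<rho>. poly_eval p x = 0"
  define v :: "complex^'m" where "v = vec_lambda x"
  have v: "($) v = x" by (simp add: v_def vec_lambda_inverse)
  show "poly_eval (tensor_poly T) x = 0"
  proof (cases "v = 0")
    case True
    then have "x = (\<lambda>i. 0 * x i)" using v by (auto simp: fun_eq_iff)
    then have "poly_eval (tensor_poly T) x = 0 ^ (k + 2) * poly_eval (tensor_poly T) x"
      using poly_eval_homogeneous_scale[OF hom, of 0 x] by metis
    then show ?thesis by simp
  next
    case False
    have "vec.span {v} \<in> unstable_locus G \<rho>"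
      unfolding unstable_locus_def zero_locus_def
    proof (intro CollectI conjI ballI)
      show "vec.span {v} \<in> proj UNIV" using False by (auto simp: proj_def)
      fix p u assume "p \<in> invariants_ge1 G \<rho>" "u \<in> vec.span {v}"
      then show "poly_eval p (($) u) = 0"
        using zero_set_invariants_ge1_scale[of G \<rho> v p] x by (auto simp: v vec.span_singleton)
    qed
    then have "vec.span {v} \<in> secant X (Suc k)" using us by blast
    moreover have "v \<in> vec.span {v}" by (rule vec.span_base) simp
    ultimately have "poly_eval (tensor_poly T) (($) v) = 0"
      using False
      by - (rule vanishes_on_secant[OF hom, of "Suc k" X "vec.span {v}"],
          rule prolongation_vanishes_on_spans[OF T X])
    then show ?thesis by (simp add: v)
  qed
qed

theorem theorem1p2:
  fixes G :: "(complex^'n^'n) set"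
    and \<rho> :: "complex^'n^'n \<Rightarrow> complex^'m^'m"
    and X :: "(complex^'m) set set"
  assumes "connected_semisimple G"
    and "irreducible_module G \<rho>"
    and "nontrivial_module G \<rho>"
    and "closed_orbit G \<rho> X"
  shows "(invariants G \<rho> \<noteq> range const_poly \<longrightarrow>
            finite {r. secant X r \<subseteq> unstable_locus G \<rho>} \<and>
            {r. secant X r \<subseteq> unstable_locus G \<rho>} \<noteq> {} \<and>
            Max {r. secant X r \<subseteq> unstable_locus G \<rho>} < min_generator_degree G \<rho>) \<and>
         (\<forall>r\<ge>1. unstable_locus G \<rho> \<subseteq> secant X r \<and> secant X r \<noteq> proj UNIV \<longrightarrow>
            tensor_poly ` prolongation (r - 1) (quadric_tensors X)
              \<subseteq> ideal_radical (is_ideal hull invariants_ge1 G \<rho>) \<inter> homogeneous (r + 1))"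
proof (intro conjI impI allI)
  note span = closed_orbit_span[OF assms(1,2,4)] closed_orbit_nonempty[OF assms(4,1)]
  let ?R = "{r. secant X r \<subseteq> unstable_locus G \<rho>}"
  assume "invariants G \<rho> \<noteq> range const_poly"
  then obtain f where f: "f \<in> invariants G \<rho>" "f \<in> homogeneous (min_generator_degree G \<rho>)" "f \<noteq> 0"
    "min_generator_degree G \<rho> > 0"
    by (rule min_generator_invariant)
  \<comment> \<open>One bound yields both the finiteness that makes \<open>Max\<close> meaningful
    and the inequality for the maximum.\<close>
  have R: "r < min_generator_degree G \<rho>" if "r \<in> ?R" for r
    using secant_not_unstable[OF span f, of r] that by simp
  then show fin: "finite ?R" by (meson finite_nat_iff_bounded lessThan_iff subsetI)
  show ne: "?R \<noteq> {}" using secant_0[of X] by auto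
  show "Max ?R < min_generator_degree G \<rho>" using R Max_in[OF fin ne] by blast
next
  fix r :: nat
  assume r: "r \<ge> 1" and us: "unstable_locus G \<rho> \<subseteq> secant X r \<and> secant X r \<noteq> proj UNIV"
  obtain k where k: "r = Suc k" using r by (cases r) auto
  show "tensor_poly ` prolongation (r - 1) (quadric_tensors X)
      \<subseteq> ideal_radical (is_ideal hull invariants_ge1 G \<rho>) \<inter> homogeneous (r + 1)"
  proof (intro image_subsetI IntI)
    fix T assume T: "T \<in> prolongation (r - 1) (quadric_tensors X)"
    then show "tensor_poly T \<in> ideal_radical (is_ideal hull invariants_ge1 G \<rho>)"
      using us by (intro prolongation_in_radical[OF closed_orbit_subset_proj[OF assms(4)]]) (auto simp: k)
    show "tensor_poly T \<in> homogeneous (r + 1)"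
      using T tensor_poly_homogeneous[of T "r + 1"] by (auto simp: k prolongation_def sym_tensors_iff)
  qed
qed

end
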